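(* Let $n\ge 1$ and let $\mathfrak{g}=\mathfrak{osp}(1,2n)$. For all homogeneous $X_1,\ldots,X_{4n+2}\in\mathfrak{g}$ one has \[\mathcal{A}_{4n+2}(X_1,\ldots,X_{4n+2})=\sum_{\sigma\in\mathfrak{S}_{4n+2}}\epsilon(\sigma)\,\epsilon(\sigma,\mathcal{X})\,X_{\sigma(1)}X_{\sigma(2)}\cdots X_{\sigma(4n+2)}=0 .\] (Equivalently, since $\mathcal{A}_{4n+2}$ is multilinear, it vanishes identically on $\mathfrak{g}^{4n+2}$.)
   Context: Let $V=V_{\bar 0}\oplus V_{\bar 1}$ be a $\mathbb{Z}_2$-graded complex vector space with $\dim V_{\bar 0}=1$, $\dim V_{\bar 1}=2n$, and let $\mathfrak{gl}(1,2n)=\mathrm{End}(V)$ with its natural $\mathbb{Z}_2$-grading and super commutator bracket $[X,Y]=XY-(-1)^{xy}YX$ (lower-case letters denote degrees of homogeneous elements). Let $\beta$ be an even nondegenerate bilinear form on $V$ that is symmetric on $V_{\bar 0}$, symplectic (skew) on $V_{\bar 1}$, with $\beta(V_{\bar 0},V_{\bar 1})=0$. Then $\mathfrak{osp}(1,2n)$ is the sub-superalgebra of $\mathfrak{gl}(1,2n)$ spanned by the homogeneous $X$ with $\beta(XY,Z)+(-1)^{xy}\beta(Y,XZ)=0$ for all homogeneous $Y,Z\in V$. Products $X_{\sigma(1)}\cdots X_{\sigma(k)}$ are compositions of endomorphisms of $V$. For $\mathcal{X}=(X_1,\ldots,X_k)$ homogeneous and $\sigma\in\mathfrak{S}_k$,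 $\epsilon(\sigma)$ is the usual sign and $\epsilon(\sigma,\mathcal{X})=(-1)^{K(\sigma,\mathcal{X})}$, where $K(\sigma,\mathcal{X})$ is the number of pairs $(i,j)$ with $i<j$, $\sigma(i)>\sigma(j)$ and both $X_{\sigma(i)},X_{\sigma(j)}$ odd. *)

theory Defs
  imports Complex_Main "HOL-Combinatorics.Permutations"
begin

text \<open>Model: V = C^(1+2n) with basis indices 0..2n; index 0 spans V_0 (even),
 indices 1..2n span V_1 (odd). Endomorphisms are matrices nat => nat => complex,
 vectors are nat => complex, both required to vanish outside the index range {0..<N}, N = 2n+1.
 Degrees are booleans: False = even, True = odd.\<close>

type_synonym mat = "nat \<Rightarrow> nat \<Rightarrow> complex"
type_synonym vec = "nat \<Rightarrow> complex"

definition idx_par :: "nat \<Rightarrow> bool" where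
  "idx_par i = (i \<noteq> 0)"

definition sgn_deg :: "bool \<Rightarrow> bool \<Rightarrow> complex" where
  "sgn_deg x y = (if x \<and> y then -1 else 1)"

definition mmul :: "nat \<Rightarrow> mat \<Rightarrow> mat \<Rightarrow> mat" where
  "mmul N A B = (\<lambda>i j. \<Sum>k<N. A i k * B k j)"

definition mone :: "nat \<Rightarrow> mat" where
  "mone N = (\<lambda>i j. if i = j \<and> i < N then 1 else 0)"

definition mprod :: "nat \<Rightarrow> mat list \<Rightarrow> mat" where
  "mprod N Ms = foldr (mmul N) Ms (mone N)"

definition mvec :: "nat \<Rightarrow> mat \<Rightarrow> vec \<Rightarrow> vec" where
  "mvec N A v = (\<lambda>i. \<Sum>k<N. A i k * v k)"

definition bil :: "nat \<Rightarrow> mat \<Rightarrow> vec \<Rightarrow> vec \<Rightarrow> complex" where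
  "bil N B v w = (\<Sum>i<N. \<Sum>j<N. v i * B i j * w j)"

definition hom_vec :: "nat \<Rightarrow> bool \<Rightarrow> vec \<Rightarrow> bool" where
  "hom_vec N d v \<longleftrightarrow> (\<forall>i. v i \<noteq> 0 \<longrightarrow> i < N \<and> idx_par i = d)"

definition hom_mat :: "nat \<Rightarrow> bool \<Rightarrow> mat \<Rightarrow> bool" where
  "hom_mat N d X \<longleftrightarrow> (\<forall>i j. X i j \<noteq> 0 \<longrightarrow> i < N \<and> j < N \<and> (idx_par i \<noteq> idx_par j) = d)"

definition osp_form :: "nat \<Rightarrow> mat \<Rightarrow> bool" where
  "osp_form n B \<longleftrightarrow> (let N = 2*n+1 in
     (\<forall>i<N. \<forall>j<N. idx_par i \<noteq> idx_par j \<longrightarrow> B i j = 0) \<and>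
     (\<forall>i<N. \<forall>j<N. \<not> idx_par i \<and> \<not> idx_par j \<longrightarrow> B i j = B j i) \<and>
     (\<forall>i<N. \<forall>j<N. idx_par i \<and> idx_par j \<longrightarrow> B i j = - B j i) \<and>
     (\<forall>v. (\<forall>k\<ge>N. v k = 0) \<longrightarrow> (\<forall>w. bil N B v w = 0) \<longrightarrow> v = (\<lambda>_. 0)))"

definition hom_osp :: "nat \<Rightarrow> mat \<Rightarrow> bool \<Rightarrow> mat \<Rightarrow> bool" where
  "hom_osp n B x X \<longleftrightarrow> (let N = 2*n+1 in hom_mat N x X \<and>
     (\<forall>y z Y Z. hom_vec N y Y \<longrightarrow> hom_vec N z Z \<longrightarrow>
        bil N B (mvec N X Y) Z + sgn_deg x y * bil N B Y (mvec N X Z) = 0))"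

definition Kinv :: "nat \<Rightarrow> (nat \<Rightarrow> nat) \<Rightarrow> (nat \<Rightarrow> bool) \<Rightarrow> nat" where
  "Kinv m \<sigma> p = card {(i, j). i < j \<and> j < m \<and> \<sigma> i > \<sigma> j \<and> p (\<sigma> i) \<and> p (\<sigma> j)}"

definition superA :: "nat \<Rightarrow> nat \<Rightarrow> (nat \<Rightarrow> mat) \<Rightarrow> (nat \<Rightarrow> bool) \<Rightarrow> mat" where
  "superA N m X p = (\<lambda>i j. \<Sum>\<sigma>\<in>{\<sigma>. \<sigma> permutes {0..<m}}.
      of_int (sign \<sigma>) * (-1) ^ Kinv m \<sigma> p * mprod N (map (\<lambda>k. X (\<sigma> k)) [0..<m]) i j)"

end

theory Submission
  imports "Jordan_Normal_Form.Char_Poly" "HOL-Library.Function_Algebras" Defs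
begin

text \<open>
  Attach to every \<open>X\<^sub>k\<close> a generator \<open>\<theta>\<^sub>k\<close> with square zero, subject to the commutation signs of
  the alternating sum, and put \<open>\<Theta> = \<Sum> \<theta>\<^sub>k X\<^sub>k\<close>; then \<open>\<A>\<^sub>m\<close> is the coefficient of
  \<open>\<theta>\<^sub>1 \<dots> \<theta>\<^sub>m\<close> in \<open>\<Theta>\<^sup>m\<close>, and it suffices that \<open>Q\<^sup>2\<^sup>n\<^sup>+\<^sup>1 = 0\<close> for \<open>Q = \<Theta>\<^sup>2\<close>. Since \<open>\<Theta>\<close> is odd,
  the supertraces of all powers \<open>Q\<^sup>k\<close>, \<open>k \<ge> 1\<close>, vanish. The block form of \<open>Q\<close> is
  \<open>Q = ((0, a), (b, M))\<close> with \<open>M\<close> over a commutative ring and \<open>a\<close>, \<open>b\<close> odd, and \<open>Q\<close> preserves the form.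

  If \<open>M\<close> is invertible, orthosymplecticity gives \<open>a M\<^sup>-\<^sup>1 b = 0\<close>, so that \<open>(1, - M\<^sup>-\<^sup>1 b)\<close> spans the
  kernel of \<open>Q\<close> and \<open>Q\<close> induces \<open>P = M + M\<^sup>-\<^sup>1 b a\<close> on the quotient. The traces of the powers of \<open>P\<close> are,
  up to sign, the supertraces of the powers of \<open>Q\<close>; the theorem of Cayley and Hamilton for \<open>P\<close>, with
  its coefficients expressed through traces by Le Verrier's recursion, becomes an identity for \<open>Q\<close> of
  degree \<open>2n + 1\<close> whose coefficients are polynomials in supertraces. In general, replace \<open>M\<close> by
  \<open>M + z G\<^sup>-\<^sup>1\<close> over the polynomial ring in \<open>z\<close>, where \<open>G\<close> is the skew form: it becomes invertible after
  localisation at a monic polynomial, and the identity survives the specialisation \<open>z = 0\<close>.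
\<close>

section \<open>Le Verrier's recursion over a commutative ring\<close>

text \<open>Only the summation range is recorded; row and column indices are free, so the same
  product serves square blocks, rows and columns.\<close>

definition mm :: "nat \<Rightarrow> (nat \<Rightarrow> nat \<Rightarrow> 'a::semiring_0) \<Rightarrow> (nat \<Rightarrow> nat \<Rightarrow> 'a) \<Rightarrow> nat \<Rightarrow> nat \<Rightarrow> 'a" where
  "mm N A B = (\<lambda>i j. \<Sum>k<N. A i k * B k j)"

text \<open>Not cut off at a size, so the unit laws hold for indices below \<open>N\<close> only;
  many equations below are therefore entrywise and carry bounds.\<close>

definition mid :: "nat \<Rightarrow> nat \<Rightarrow> 'a::semiring_1" where
  "mid = (\<lambda>i j. if i = j then 1 else 0)"

definition tr :: "nat \<Rightarrow> (nat \<Rightarrow> nat \<Rightarrow> 'a::comm_monoid_add) \<Rightarrow> 'a" where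
  "tr N A = (\<Sum>i<N. A i i)"

primrec mpow :: "nat \<Rightarrow> (nat \<Rightarrow> nat \<Rightarrow> 'a::semiring_1) \<Rightarrow> nat \<Rightarrow> nat \<Rightarrow> nat \<Rightarrow> 'a" where
  "mpow N A 0 = mid"
| "mpow N A (Suc k) = mm N A (mpow N A k)"

lemma mm_assoc: "mm N (mm L A B) C = mm L A (mm N B C)"
proof (intro ext)
  fix i j
  have "mm N (mm L A B) C i j = (\<Sum>k<N. \<Sum>l<L. A i l * B l k * C k j)"
    by (simp add: mm_def sum_distrib_right)
  also have "\<dots> = (\<Sum>l<L. \<Sum>k<N. A i l * B l k * C k j)" by (rule sum.swap)
  also have "\<dots> = mm L A (mm N B C) i j" by (simp add: mm_def sum_distrib_left mult.assoc)
  finally show "mm N (mm L A B) C i j = mm L A (mm N B C) i j" .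
qed

lemma mm_cong:
  assumes "\<And>k. k < N \<Longrightarrow> A i k = A' i k" "\<And>k. k < N \<Longrightarrow> B k j = B' k j"
  shows "mm N A B i j = mm N A' B' i j"
  using assms by (simp add: mm_def)

lemma mm_mid_left: "i < N \<Longrightarrow> mm N mid A i j = A i j"
proof -
  assume "i < N"
  have "mm N mid A i j = (\<Sum>k<N. if i = k then A i j else 0)"
    unfolding mm_def mid_def by (intro sum.cong refl) auto
  with \<open>i < N\<close> show ?thesis by simp
qed

lemma mm_mid_right: "j < N \<Longrightarrow> mm N A mid i j = A i j"
proof -
  assume "j < N"
  have "mm N A mid i j = (\<Sum>k<N. if k = j then A i j else 0)"
    unfolding mm_def mid_def by (intro sum.cong refl) auto
  with \<open>j < N\<close> show ?thesis by simp
qed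

lemma tr_cong: "(\<And>i. i < N \<Longrightarrow> A i i = B i i) \<Longrightarrow> tr N A = tr N B"
  by (simp add: tr_def)

lemma tr_comm: "tr N (mm N A B) = tr N (mm N B (A :: nat \<Rightarrow> nat \<Rightarrow> 'a::comm_semiring_0))"
  unfolding tr_def mm_def by (subst sum.swap) (simp add: mult.commute)

text \<open>\<open>lev s N j\<close> is \<open>(-1)\<^sup>N N!\<close> times the coefficient of \<open>t\<^sup>j\<close> in the characteristic polynomial of an
  \<open>N \<times> N\<close> matrix whose \<open>i\<close>-th power has trace \<open>s i\<close>; the factorial avoids division.\<close>

primrec lev :: "(nat \<Rightarrow> 'a::comm_ring_1) \<Rightarrow> nat \<Rightarrow> nat \<Rightarrow> 'a" where
  "lev s 0 = (\<lambda>j. if j = 0 then 1 else 0)"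
| "lev s (Suc k) = (\<lambda>j. case j of 0 \<Rightarrow> \<Sum>l\<le>k. lev s k l * s (Suc l)
                               | Suc l \<Rightarrow> - of_nat (Suc k) * lev s k l)"

section \<open>Formal derivatives over a commutative ring and Jacobi's formula\<close>

definition der :: "'a::comm_ring_1 poly \<Rightarrow> 'a poly" where
  "der p = Abs_poly (\<lambda>n. of_nat (Suc n) * coeff p (Suc n))"

lemma coeff_der: "coeff (der p) n = of_nat (Suc n) * coeff p (Suc n)"
proof -
  have "\<forall>\<^sub>\<infinity>n. of_nat (Suc n) * coeff p (Suc n) = 0"
    unfolding MOST_nat using coeff_eq_0[of p] by (metis less_SucI mult_zero_right)
  then show ?thesis unfolding der_def by (simp add: Abs_poly_inverse)
qed

lemma der_add: "der (p + q) = der p + der q"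
  by (simp add: poly_eq_iff coeff_der algebra_simps)

lemma der_smult: "der (Polynomial.smult c p) = Polynomial.smult c (der p)"
  by (simp add: poly_eq_iff coeff_der algebra_simps)

lemma der_0: "der 0 = 0" and der_1: "der 1 = 0"
  by (simp_all add: poly_eq_iff coeff_der)

lemma der_minus: "der (- p) = - der p"
  by (simp add: poly_eq_iff coeff_der algebra_simps)

lemma der_sum: "der (sum f A) = (\<Sum>x\<in>A. der (f x))"
  by (induction A rule: infinite_finite_induct) (simp_all add: der_0 der_add)

lemma der_pCons: "der (pCons a p) = p + pCons 0 (der p)"
  by (simp add: poly_eq_iff coeff_der algebra_simps coeff_pCons split: nat.split)

lemma der_mult: "der (p * q) = der p * q + p * der q"
proof (induction p)
  case 0
  then show ?case by (simp add: der_0)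
next
  case (pCons a p)
  then show ?case
    by (simp add: der_add der_smult der_pCons algebra_simps)
qed

lemma der_prod:
  "finite A \<Longrightarrow> der (prod f A) = (\<Sum>i\<in>A. \<Prod>j\<in>A. if j = i then der (f j) else f j)"
proof (induction A rule: finite_induct)
  case empty
  then show ?case by (simp add: der_1)
next
  case (insert x A)
  have "(\<Sum>i\<in>insert x A. \<Prod>j\<in>insert x A. if j = i then der (f j) else f j)
     = (\<Prod>j\<in>insert x A. if j = x then der (f j) else f j)
       + (\<Sum>i\<in>A. f x * (\<Prod>j\<in>A. if j = i then der (f j) else f j))"
    using insert.hyps by (auto intro!: sum.cong simp: sum.insert)
  also have "(\<Prod>j\<in>insert x A. if j = x then der (f j) else f j) = der (f x) * prod f A"
  proof -
    have "(\<Prod>j\<in>A. if j = x then der (f j) else f j) = prod f A"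
      using insert.hyps by (intro prod.cong) auto
    then show ?thesis using insert.hyps by simp
  qed
  finally show ?case
    using insert by (simp add: der_mult sum_distrib_left)
qed

text \<open>Each term of the Leibniz expansion has one factor per row, so the product rule
  differentiates one row at a time.\<close>

lemma der_det:
  fixes A :: "'a::comm_ring_1 poly Matrix.mat"
  assumes A: "A \<in> carrier_mat n n"
  shows "der (det A) =
    (\<Sum>i<n. det (mat n n (\<lambda>(r, c). if r = i then der (A $$ (r, c)) else A $$ (r, c))))"
proof -
  have s: "der (signof p * q) = signof p * der q" for p :: "nat \<Rightarrow> nat" and q :: "'a poly"
    by (cases p rule: sign_cases) (simp_all add: der_minus)
  have m: "mat n n f \<in> carrier_mat n n" for f :: "nat \<times> nat \<Rightarrow> 'a poly" by simp
  have "der (det A) = (\<Sum>p | p permutes {0..<n}. \<Sum>i<n. signof p *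
      (\<Prod>j = 0..<n. if j = i then der (A $$ (j, p j)) else A $$ (j, p j)))"
    by (simp add: det_def'[OF A] der_sum s der_prod sum_distrib_left atLeast0LessThan)
  also have "\<dots> = (\<Sum>i<n. \<Sum>p | p permutes {0..<n}. signof p *
      (\<Prod>j = 0..<n. if j = i then der (A $$ (j, p j)) else A $$ (j, p j)))"
    by (rule sum.swap)
  also have "\<dots> = (\<Sum>i<n. det (mat n n (\<lambda>(r, c). if r = i then der (A $$ (r, c)) else A $$ (r, c))))"
    unfolding det_def'[OF m]
    by (intro sum.cong refl arg_cong2[where f = "(*)"] prod.cong) (auto simp: permutes_in_image)
  finally show ?thesis .
qed

text \<open>Jacobi's formula: the derivative of row \<open>i\<close> of \<open>t I - A\<close> is a
  unit vector, so Laplace expansion along it leaves the \<open>i\<close>-th diagonal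
  cofactor.\<close>

lemma der_char_poly:
  fixes A :: "'a::comm_ring_1 Matrix.mat"
  assumes A: "A \<in> carrier_mat n n"
  shows "der (char_poly A) = (\<Sum>i<n. adj_mat (char_poly_matrix A) $$ (i, i))"
proof -
  let ?C = "char_poly_matrix A"
  have C: "?C \<in> carrier_mat n n" using A by simp
  have "det (mat n n (\<lambda>(r, c). if r = i then der (?C $$ (r, c)) else ?C $$ (r, c)))
      = adj_mat ?C $$ (i, i)" (is "det ?D = _") if i: "i < n" for i
  proof -
    have D: "?D \<in> carrier_mat n n" by simp
    have "det ?D = (\<Sum>j<n. ?D $$ (i, j) * cofactor ?D i j)"
      by (rule laplace_expansion_row[OF D i])
    also have "\<dots> = (\<Sum>j<n. if j = i then cofactor ?D i i else 0)"
    proof (intro sum.cong refl)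
      fix j assume "j \<in> {..<n}"
      then show "?D $$ (i, j) * cofactor ?D i j = (if j = i then cofactor ?D i i else 0)"
        using A i by (auto simp: char_poly_matrix_def der_pCons der_0 der_1)
    qed
    also have "\<dots> = cofactor ?D i i" using i by simp
    also have "cofactor ?D i i = cofactor ?C i i"
      unfolding cofactor_def using C i
      by (intro arg_cong2[where f = "(*)"] refl arg_cong[where f = det] eq_matI)
         (auto simp: mat_delete_def)
    finally show ?thesis using C i by (simp add: adj_mat_def)
  qed
  then show ?thesis by (simp add: char_poly_def der_det[OF C])
qed

text \<open>Let \<open>\<alpha> l\<close> be the coefficients of \<open>adj (t I - P)\<close>.
  Comparing coefficients in \<open>(t I - P) adj (t I - P) = \<chi> I\<close> gives
  \<open>P \<alpha>(l+1) = \<alpha> l - \<chi>(l+1) I\<close>, and Jacobi's formula gives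
  \<open>tr (\<alpha> l) = (l+1) \<chi>(l+1)\<close>. Together they yield the Faddeev-LeVerrier
  recursion without any division.\<close>

theorem leverrier:
  fixes P :: "nat \<Rightarrow> nat \<Rightarrow> 'a::comm_ring_1"
  assumes i: "i < N" and j: "j < N"
  shows "(\<Sum>l\<le>N. lev (\<lambda>i. tr N (mpow N P i)) N l * mpow N P l i j) = 0"
proof -
  define s where "s = (\<lambda>i. tr N (mpow N P i))"
  define A where "A = mat N N (\<lambda>(i, j). P i j)"
  define \<chi> where "\<chi> = coeff (char_poly A)"
  define \<alpha> where "\<alpha> l = (\<lambda>i j. coeff (adj_mat (char_poly_matrix A) $$ (i, j)) l)" for l
  let ?C = "char_poly_matrix A"
  have A: "A \<in> carrier_mat N N" by (simp add: A_def)
  then have C: "?C \<in> carrier_mat N N" by simp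
  have adj: "adj_mat ?C \<in> carrier_mat N N" "?C * adj_mat ?C = det ?C \<cdot>\<^sub>m 1\<^sub>m N"
    using adj_mat[OF C] by auto
  have entry: "pCons 0 (adj_mat ?C $$ (i, j)) - (\<Sum>k<N. Polynomial.smult (P i k) (adj_mat ?C $$ (k, j)))
      = (if i = j then char_poly A else 0)" if ij: "i < N" "j < N" for i j
  proof -
    have "(?C * adj_mat ?C) $$ (i, j) = (\<Sum>k<N. ?C $$ (i, k) * adj_mat ?C $$ (k, j))"
      using C adj(1) ij by (auto simp: times_mat_def scalar_prod_def atLeast0LessThan intro!: sum.cong)
    also have "\<dots> = (\<Sum>k<N. (if i = k then pCons 0 (adj_mat ?C $$ (i, j)) else 0)
        - Polynomial.smult (P i k) (adj_mat ?C $$ (k, j)))"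
      using ij by (intro sum.cong refl) (auto simp: char_poly_matrix_def A_def algebra_simps)
    also have "\<dots> = pCons 0 (adj_mat ?C $$ (i, j)) - (\<Sum>k<N. Polynomial.smult (P i k) (adj_mat ?C $$ (k, j)))"
      using ij by (simp add: sum_subtractf)
    finally show ?thesis using adj(2) ij by (auto simp: char_poly_def split: if_splits)
  qed
  have rec0: "mm N P (\<alpha> 0) i j = - (if i = j then \<chi> 0 else 0)" if "i < N" "j < N" for i j
    using arg_cong[OF arg_cong[OF entry[OF that], of "\<lambda>p. coeff p 0"], of uminus]
    by (auto simp: mm_def \<alpha>_def \<chi>_def coeff_sum split: if_splits)
  have rec: "mm N P (\<alpha> (Suc l)) i j = \<alpha> l i j - (if i = j then \<chi> (Suc l) else 0)"
    if "i < N" "j < N" for i j l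
    using arg_cong[OF entry[OF that], of "\<lambda>p. coeff p (Suc l)"]
    by (auto simp: mm_def \<alpha>_def \<chi>_def coeff_sum algebra_simps split: if_splits)
  have deg: "\<chi> N = 1" "\<chi> l = 0" if "l > N" for l
    using degree_monic_char_poly[OF A] that by (auto simp: \<chi>_def coeff_eq_0)
  have high: "\<alpha> l i j = 0" if "l \<ge> N" "i < N" "j < N" for l i j
  proof -
    \<comment> \<open>An index above \<open>l\<close> and above all degrees in the adjugate;
      downward induction from it by \<open>rec\<close> arrives at \<open>l\<close>.\<close>
    define L where "L = Max ((\<lambda>(i, j). degree (adj_mat ?C $$ (i, j))) ` ({..<N} \<times> {..<N})) + l + 1"
    have "L \<ge> l" by (simp add: L_def)
    have top: "\<alpha> L i j = 0" if "i < N" "j < N" for i j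
    proof -
      have "degree (adj_mat ?C $$ (i, j)) \<le> Max ((\<lambda>(i, j). degree (adj_mat ?C $$ (i, j))) ` ({..<N} \<times> {..<N}))"
        using that by (intro Max_ge) auto
      then show ?thesis by (simp add: \<alpha>_def L_def coeff_eq_0)
    qed
    have "\<forall>i<N. \<forall>j<N. \<alpha> l i j = 0" using \<open>L \<ge> l\<close> \<open>l \<ge> N\<close>
    proof (induction l rule: inc_induct)
      case base
      then show ?case using top by blast
    next
      case (step n)
      then have "mm N P (\<alpha> (Suc n)) i j = 0" if "i < N" "j < N" for i j
        using that by (simp add: mm_def)
      then show ?case using rec[of _ _ n] deg(2)[of "Suc n"] step.prems by auto
    qed
    then show ?thesis using that by blast
  qed
  have tr\<alpha>: "tr N (\<alpha> l) = of_nat (Suc l) * \<chi> (Suc l)" for l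
    using arg_cong[OF der_char_poly[OF A], of "\<lambda>p. coeff p l"]
    by (simp add: tr_def \<alpha>_def \<chi>_def coeff_sum coeff_der)
  \<comment> \<open>The recursion of \<open>lev\<close> is made so that
    \<open>L (k+1) = tr (P L k) I - (k+1) P L k\<close>.\<close>
  define L where "L k = (\<lambda>i j. \<Sum>l\<le>k. lev s k l * mpow N P l i j)" for k
  have mmL: "mm N P (L k) i j = (\<Sum>l\<le>k. lev s k l * mpow N P (Suc l) i j)" for k i j
  proof -
    have "mm N P (L k) i j = (\<Sum>m<N. \<Sum>l\<le>k. lev s k l * (P i m * mpow N P l m j))"
      by (simp add: mm_def L_def sum_distrib_left mult.left_commute)
    also have "\<dots> = (\<Sum>l\<le>k. \<Sum>m<N. lev s k l * (P i m * mpow N P l m j))" by (rule sum.swap)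
    finally show ?thesis by (simp add: mm_def sum_distrib_left)
  qed
  have trL: "tr N (mm N P (L k)) = (\<Sum>l\<le>k. lev s k l * s (Suc l))" for k
    unfolding tr_def mmL s_def by (subst sum.swap) (simp add: sum_distrib_left tr_def)
  have L_Suc: "L (Suc k) i j = (if i = j then tr N (mm N P (L k)) else 0)
      - of_nat (Suc k) * mm N P (L k) i j" for k i j
  proof -
    have "L (Suc k) i j = lev s (Suc k) 0 * mid i j
        + (\<Sum>l\<le>k. lev s (Suc k) (Suc l) * mpow N P (Suc l) i j)"
      unfolding L_def by (subst sum.atMost_Suc_shift) simp
    also have "(\<Sum>l\<le>k. lev s (Suc k) (Suc l) * mpow N P (Suc l) i j)
        = - of_nat (Suc k) * mm N P (L k) i j"
      by (simp only: mmL sum_distrib_left lev.simps nat.case mult.assoc)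
    finally show ?thesis by (simp add: mid_def trL algebra_simps)
  qed
  \<comment> \<open>The partial sums are the adjugate coefficients up to \<open>(-1)^k k!\<close>.
    In the trace, \<open>tr (\<alpha> m) - N \<chi>(m+1)\<close> leaves
    \<open>- (k+1) \<chi>(m+1)\<close>, which cancels the scalar part of
    \<open>P L k\<close>.\<close>
  have main: "L k i j = (-1) ^ k * of_nat (fact k) * \<alpha> (N - 1 - k) i j" if "k < N" "i < N" "j < N" for k i j
    using that
  proof (induction k arbitrary: i j)
    case 0
    have "mm N P (\<alpha> N) i j = 0" using high 0 by (simp add: mm_def)
    then show ?case using rec[of i j "N - 1"] 0 deg(1)[of "Suc N"]
      by (simp add: L_def mid_def split: if_splits)
  next
    case (Suc k)
    define m where "m = N - 1 - Suc k"
    have m: "N - 1 - k = Suc m" "N = Suc m + Suc k" using Suc.prems by (auto simp: m_def)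
    let ?c = "(-1) ^ k * of_nat (fact k) :: 'a"
    have PL: "mm N P (L k) i j = ?c * (\<alpha> m i j - (if i = j then \<chi> (Suc m) else 0))"
      if "i < N" "j < N" for i j
    proof -
      have "mm N P (L k) i j = (\<Sum>l<N. ?c * (P i l * \<alpha> (Suc m) l j))"
        unfolding mm_def using Suc.IH Suc.prems that m(1) by (intro sum.cong) (auto simp: algebra_simps)
      also have "\<dots> = ?c * mm N P (\<alpha> (Suc m)) i j" by (simp add: mm_def sum_distrib_left)
      finally show ?thesis using rec that by simp
    qed
    have "tr N (mm N P (L k)) = (\<Sum>i<N. ?c * (\<alpha> m i i - \<chi> (Suc m)))"
      unfolding tr_def using PL by (intro sum.cong) auto
    also have "\<dots> = ?c * (tr N (\<alpha> m) - of_nat N * \<chi> (Suc m))"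
      by (simp add: tr_def sum_subtractf flip: sum_distrib_left)
    also have "\<dots> = - (?c * of_nat (Suc k) * \<chi> (Suc m))"
    proof -
      have "of_nat N = (of_nat (Suc m) + of_nat (Suc k) :: 'a)" using m(2) by (simp only: of_nat_add)
      then show ?thesis unfolding tr\<alpha> by (simp only: algebra_simps) simp
    qed
    finally have trPL: "tr N (mm N P (L k)) = - (?c * of_nat (Suc k) * \<chi> (Suc m))" .
    show ?case
      unfolding L_Suc trPL PL[OF Suc.prems(2,3)] m_def[symmetric] by (simp add: algebra_simps)
  qed
  show ?thesis
  proof (cases N)
    case 0
    then show ?thesis using i by simp
  next
    case (Suc k)
    let ?c = "(-1) ^ k * of_nat (fact k) :: 'a"
    \<comment> \<open>The recursion closes: \<open>P L (N-1)\<close> is a scalar matrix, so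
      \<open>N\<close> times it is its trace times the identity, and the two terms of
      \<open>L N\<close> cancel.\<close>
    have PL: "mm N P (L k) i j = - ?c * (if i = j then \<chi> 0 else 0)" if "i < N" "j < N" for i j
    proof -
      have "mm N P (L k) i j = (\<Sum>l<N. ?c * (P i l * \<alpha> 0 l j))"
        unfolding mm_def using main[of k] Suc that by (intro sum.cong) (auto simp: algebra_simps)
      also have "\<dots> = ?c * mm N P (\<alpha> 0) i j" by (simp add: mm_def sum_distrib_left)
      finally show ?thesis using rec0 that by simp
    qed
    have "tr N (mm N P (L k)) = - (of_nat N * ?c * \<chi> 0)"
      unfolding tr_def using PL by simp
    then have "L (Suc k) i j = 0" using PL[OF i j] Suc by (simp add: L_Suc)
    then show ?thesis by (simp add: L_def Suc s_def)
  qed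
qed

section \<open>The characteristic identity of an orthosymplectic block matrix\<close>

definition smul :: "'a::semiring_0 \<Rightarrow> (nat \<Rightarrow> nat \<Rightarrow> 'a) \<Rightarrow> nat \<Rightarrow> nat \<Rightarrow> 'a" where
  "smul c A = (\<lambda>i j. c * A i j)"

lemma mm_add_left: "mm N (A + B) C = mm N A C + mm N B C"
  by (auto simp: mm_def fun_eq_iff distrib_right sum.distrib)

lemma mm_add_right: "mm N A (B + C) = mm N A B + mm N A C"
  by (auto simp: mm_def fun_eq_iff distrib_left sum.distrib)

lemma mm_smul_left: "mm N (smul c A) B = smul c (mm N A B)"
  by (simp add: mm_def smul_def sum_distrib_left mult.assoc)

lemma mm_smul_right: "mm N A (smul c B) = smul c (mm N A (B :: nat \<Rightarrow> nat \<Rightarrow> 'a::comm_semiring_0))"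
  by (simp add: mm_def smul_def sum_distrib_left mult.left_commute)

lemma smul_smul: "smul a (smul b A) = smul (a * b) A"
  by (simp add: smul_def mult.assoc)

lemma smul_add: "smul a (A + B) = smul a A + smul a B"
  by (auto simp: smul_def fun_eq_iff distrib_left)

lemma smul_1: "smul 1 A = (A :: nat \<Rightarrow> nat \<Rightarrow> 'a::semiring_1)"
  by (simp add: smul_def)

lemma smul_0_right: "smul a 0 = 0"
  by (simp add: smul_def fun_eq_iff)

lemma mm_0_left: "mm N 0 A = 0"
  by (simp add: mm_def fun_eq_iff)

lemma mm_0_right: "mm N A 0 = 0"
  by (simp add: mm_def fun_eq_iff)

lemma tr_smul: "tr N (smul c A) = c * tr N A"
  by (simp add: tr_def smul_def sum_distrib_left)

lemma tr_add: "tr N (A + B) = tr N A + tr N B"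
  by (simp add: tr_def sum.distrib)

lemma mpow_Suc2:
  "i < N \<Longrightarrow> j < N \<Longrightarrow> mpow N A (Suc k) i j = mm N (mpow N A k) A i j"
proof (induction k arbitrary: i)
  case 0
  then show ?case by (simp add: mm_mid_left mm_mid_right)
next
  case (Suc k)
  have "mpow N A (Suc (Suc k)) i j = mm N A (mm N (mpow N A k) A) i j"
    using Suc by (subst mpow.simps(2), intro mm_cong) auto
  also have "\<dots> = mm N (mpow N A (Suc k)) A i j" by (simp add: mm_assoc)
  finally show ?case .
qed

text \<open>For \<open>Q = ((0, a), (b, M))\<close> and \<open>K = b a\<close>, \<open>blk N M K k\<close> is the lower right block of \<open>Q\<^sup>k\<close>, and
  \<open>blk_str N M K k\<close> below is minus the supertrace of \<open>Q\<^sup>k\<close> for \<open>k \<ge> 1\<close>.\<close>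

fun blk :: "nat \<Rightarrow> (nat \<Rightarrow> nat \<Rightarrow> 'a::semiring_1) \<Rightarrow> (nat \<Rightarrow> nat \<Rightarrow> 'a) \<Rightarrow> nat \<Rightarrow> nat \<Rightarrow> nat \<Rightarrow> 'a" where
  "blk N M K 0 = mid"
| "blk N M K (Suc 0) = mm N M mid"
| "blk N M K (Suc (Suc k)) = mm N M (blk N M K (Suc k)) + mm N K (blk N M K k)"

lemma blk_Suc_Suc:
  "blk N M K (Suc (Suc k)) = mm N M (blk N M K (Suc k)) + mm N K (blk N M K k)"
  by (simp add: fun_eq_iff)

declare blk.simps(3) [simp del]

definition blk_str :: "nat \<Rightarrow> (nat \<Rightarrow> nat \<Rightarrow> 'a::semiring_1) \<Rightarrow> (nat \<Rightarrow> nat \<Rightarrow> 'a) \<Rightarrow> nat \<Rightarrow> 'a" where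
  "blk_str N M K k = tr N (blk N M K k) + (if k < 2 then 0 else tr N (mm N K (blk N M K (k - 2))))"

text \<open>If \<open>s i\<close> is given weight \<open>i\<close>, the coefficient
  \<open>lev s k j\<close> is homogeneous of weight \<open>k - j\<close>.\<close>

lemma lev_scale:
  assumes "\<And>i. t (Suc i) = d ^ Suc i * s (Suc i)"
  shows "j \<le> k \<Longrightarrow> lev t k j * d ^ j = d ^ k * lev s k j"
proof (induction k arbitrary: j)
  case (Suc k)
  show ?case
  proof (cases j)
    case 0
    have "(\<Sum>l\<le>k. lev t k l * t (Suc l)) = (\<Sum>l\<le>k. (lev t k l * d ^ l) * (d * s (Suc l)))"
      by (intro sum.cong) (simp_all add: assms algebra_simps)
    also have "\<dots> = (\<Sum>l\<le>k. d ^ Suc k * (lev s k l * s (Suc l)))"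
      using Suc.IH by (intro sum.cong) (simp_all add: algebra_simps)
    finally show ?thesis by (simp add: 0 sum_distrib_left)
  next
    case (Suc l)
    then show ?thesis using Suc.IH[of l] Suc.prems by (simp add: algebra_simps)
  qed
qed simp

text \<open>When all power traces vanish, the characteristic polynomial is a pure power of the
  variable.\<close>

lemma lev_zero:
  assumes "\<And>i. s (Suc i) = 0"
  shows "lev s k j = (if j = k then (-1) ^ k * of_nat (fact k) else 0)"
proof (induction k arbitrary: j)
  case (Suc k)
  then show ?case by (cases j) (auto simp: assms algebra_simps)
qed simp

text \<open>\<open>W\<close> plays the role of \<open>d M\<^sup>-\<^sup>1\<close>, and \<open>P = d M + W K\<close> that of \<open>d (M + M\<^sup>-\<^sup>1 K)\<close>, in the localisation
  at \<open>d\<close>; the two families \<open>M P\<^sup>k = d\<^sup>k blk (k + 1)\<close> and \<open>L P\<^sup>k = d\<^sup>k L blk k\<close> clear the denominators.\<close>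

lemma blk_identity_regular:
  fixes M K W L :: "nat \<Rightarrow> nat \<Rightarrow> 'a::comm_ring_1"
  assumes MWK: "mm N M (mm N W K) = smul d K"
    and KWK: "mm N K (mm N W K) = 0"
    and LWK: "mm N L (mm N W K) = 0"
    and trWK: "tr N (mm N W K) = 0"
    and j: "j < N"
  defines "s \<equiv> blk_str N M K"
  shows "d ^ N * (\<Sum>l\<le>N. lev s N l * blk N M K (Suc l) i j) = 0"
    and "d ^ N * (\<Sum>l\<le>N. lev s N l * mm N L (blk N M K l) i j) = 0"
proof -
  define P where "P = smul d M + mm N W K"
  have P: "mpow N P (Suc k) = smul d (mm N M (mpow N P k)) + mm N W (mm N K (mpow N P k))" for k
    by (simp add: P_def mm_add_left mm_smul_left mm_assoc)
  have vanish: "mm N A (mm N W (mm N K B)) = 0" if "mm N A (mm N W K) = 0" for A B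
    using arg_cong[OF that, of "\<lambda>X. mm N X B"] by (simp add: mm_assoc mm_0_left)
  have MW: "mm N M (mm N W (mm N K B)) = smul d (mm N K B)" for B
    using arg_cong[OF MWK, of "\<lambda>X. mm N X B"] by (simp add: mm_assoc mm_smul_left)
  have MK: "mm N M (mpow N P k) = smul (d ^ k) (blk N M K (Suc k)) \<and>
      mm N K (mpow N P k) = smul (d ^ k) (mm N K (blk N M K k))" for k
  proof (induction k)
    \<comment> \<open>\<open>blk\<close> continues with \<open>mm N M mid\<close> instead of
      \<open>M\<close>, so that this is an equation of functions, also outside the index
      range.\<close>
    case 0
    then show ?case by (simp add: smul_1)
  next
    case (Suc k)
    show ?case
      unfolding P mm_add_right mm_smul_right MW vanish[OF KWK] conjunct1[OF Suc] conjunct2[OF Suc]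
        blk_Suc_Suc smul_smul smul_add
      by (simp add: mult.commute smul_0_right)
  qed
  have LP: "mm N L (mpow N P k) = smul (d ^ k) (mm N L (blk N M K k))" for k
  proof (cases k)
    case 0
    then show ?thesis by (simp add: smul_1)
  next
    case (Suc k')
    then show ?thesis
      unfolding Suc P mm_add_right mm_smul_right vanish[OF LWK]
      using MK[of k'] by (simp add: mm_smul_right smul_smul)
  qed
  have PWK: "mm N P (mm N W K) = smul (d * d) K"
    unfolding P_def mm_add_left mm_smul_left MWK smul_smul mm_assoc KWK mm_0_right by simp
  \<comment> \<open>The last factor \<open>P\<close> of the power is moved cyclically to the front,
    where \<open>P W K = d^2 K\<close>; at \<open>k = 0\<close> there is no such factor and
    \<open>trWK\<close> takes over.\<close>
  have s0: "tr N (mm N W (mm N K (mpow N P k))) =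
      (if k = 0 then 0 else d ^ Suc k * tr N (mm N K (blk N M K (k - 1))))" for k
  proof (cases k)
    case 0
    have "tr N (mm N W (mm N K mid)) = tr N (mm N (mm N W K) mid)" by (simp add: mm_assoc)
    also have "\<dots> = tr N (mm N W K)" by (intro tr_cong) (simp add: mm_mid_right)
    finally show ?thesis using 0 trWK by simp
  next
    case (Suc m)
    have "tr N (mm N W (mm N K (mpow N P (Suc m)))) = tr N (mm N (mm N W K) (mpow N P (Suc m)))"
      by (simp only: mm_assoc)
    also have "\<dots> = tr N (mm N (mm N W K) (mm N (mpow N P m) P))"
      by (intro tr_cong mm_cong refl mpow_Suc2)
    also have "\<dots> = tr N (mm N (mm N (mm N W K) (mpow N P m)) P)" by (simp only: mm_assoc)
    also have "\<dots> = tr N (mm N P (mm N (mm N W K) (mpow N P m)))" by (rule tr_comm)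
    also have "\<dots> = tr N (mm N (mm N P (mm N W K)) (mpow N P m))" by (simp only: mm_assoc)
    also have "\<dots> = d * d * (d ^ m * tr N (mm N K (blk N M K m)))"
      by (simp add: PWK mm_smul_left tr_smul MK)
    finally show ?thesis by (simp add: Suc mult.assoc)
  qed
  have trP: "tr N (mpow N P (Suc k)) = d ^ Suc k * s (Suc k)" for k
  proof -
    have "tr N (mpow N P (Suc k)) = d * (d ^ k * tr N (blk N M K (Suc k))) + tr N (mm N W (mm N K (mpow N P k)))"
      unfolding P tr_add tr_smul using MK[of k] by (simp add: tr_smul)
    then show ?thesis unfolding s0 s_def blk_str_def by (simp add: algebra_simps)
  qed
  \<comment> \<open>Cayley-Hamilton for \<open>P\<close>, multiplied from the left by
    \<open>A\<close>; by \<open>lev_scale\<close> the powers of \<open>d\<close> collect into the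
    common factor \<open>d ^ N\<close>.\<close>
  have lin: "d ^ N * (\<Sum>l\<le>N. lev s N l * B l i j) = 0"
    if B: "\<And>l. mm N A (mpow N P l) = smul (d ^ l) (B l)" for A B
  proof -
    have "(\<Sum>k<N. A i k * (\<Sum>l\<le>N. lev (\<lambda>i. tr N (mpow N P i)) N l * mpow N P l k j)) = 0"
      using leverrier[OF _ j, where P = P] by simp
    also have "(\<Sum>k<N. A i k * (\<Sum>l\<le>N. lev (\<lambda>i. tr N (mpow N P i)) N l * mpow N P l k j))
        = (\<Sum>l\<le>N. lev (\<lambda>i. tr N (mpow N P i)) N l * mm N A (mpow N P l) i j)"
      unfolding sum_distrib_left mm_def by (subst sum.swap) (simp add: mult.left_commute)
    also have "\<dots> = (\<Sum>l\<le>N. lev (\<lambda>i. tr N (mpow N P i)) N l * d ^ l * B l i j)"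
      unfolding B by (simp add: smul_def mult.assoc)
    also have "\<dots> = (\<Sum>l\<le>N. d ^ N * lev s N l * B l i j)"
      using trP by (intro sum.cong refl arg_cong2[where f = "(*)"] lev_scale) auto
    finally show ?thesis by (simp add: sum_distrib_left mult.assoc)
  qed
  show "d ^ N * (\<Sum>l\<le>N. lev s N l * blk N M K (Suc l) i j) = 0"
    by (rule lin[where A = M]) (use MK in blast)
  show "d ^ N * (\<Sum>l\<le>N. lev s N l * mm N L (blk N M K l) i j) = 0"
    by (rule lin[where A = L]) (rule LP)
qed

section \<open>Specialisation to an arbitrary lower right block\<close>

lemma adj_mat_symmetric:
  assumes A: "A \<in> carrier_mat n n" and sym: "A\<^sup>T = A" and ij: "i < n" "j < n"
  shows "adj_mat A $$ (i, j) = adj_mat A $$ (j, i)"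
proof -
  \<comment> \<open>By symmetry of \<open>A\<close>, the minors at (i, j) and (j, i) are transposes
    of each other.\<close>
  have "mat_delete A i j = (mat_delete A j i)\<^sup>T"
  proof (rule eq_matI)
    fix r c
    assume rc: "r < dim_row (mat_delete A j i)\<^sup>T" "c < dim_col (mat_delete A j i)\<^sup>T"
    have "A $$ (p, q) = A $$ (q, p)" if "p < n" "q < n" for p q
      using A that arg_cong[OF sym, of "\<lambda>B. B $$ (p, q)"] by simp
    then show "mat_delete A i j $$ (r, c) = (mat_delete A j i)\<^sup>T $$ (r, c)"
      using A rc by (auto simp: mat_delete_def)
  qed (use A in auto)
  then have "det (mat_delete A i j) = det (mat_delete A j i)"
    using det_transpose[OF mat_delete_carrier[OF A]] by metis
  then show ?thesis using A ij by (simp add: adj_mat_def cofactor_def add.commute)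
qed

text \<open>The leading coefficient of \<open>q\<close> reappears in the product, so a monic
  polynomial is regular even over a ring with zero divisors.\<close>

lemma monic_mult_eq_0:
  fixes p q :: "'a::comm_ring_1 poly"
  assumes "coeff p (degree p) = 1" "p * q = 0"
  shows "q = 0"
  using coeff_mult_degree_sum[of p q] assms by simp

lemma coeff_0_sum_mult: "coeff (\<Sum>x\<in>A. f x * g x) 0 = (\<Sum>x\<in>A. coeff (f x) 0 * coeff (g x) 0)"
  by (simp add: coeff_sum coeff_mult_0)

text \<open>Taking constant coefficients is the ring homomorphism \<open>z = 0\<close>, and
  \<open>blk\<close> is built from sums and products.\<close>

lemma blk_coeff_0:
  fixes M K :: "nat \<Rightarrow> nat \<Rightarrow> 'a::comm_ring_1 poly"
  assumes M: "\<And>i j. i < N \<Longrightarrow> j < N \<Longrightarrow> coeff (M i j) 0 = M' i j"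
    and K: "\<And>i j. i < N \<Longrightarrow> j < N \<Longrightarrow> coeff (K i j) 0 = K' i j"
  shows "i < N \<Longrightarrow> j < N \<Longrightarrow> coeff (blk N M K k i j) 0 = blk N M' K' k i j"
proof (induction k arbitrary: i rule: induct_nat_012)
  case 0
  then show ?case by (simp add: mid_def)
next
  case 1
  then show ?case by (simp add: mm_mid_right M)
next
  case (ge2 k)
  then show ?case by (simp add: blk_Suc_Suc mm_def coeff_0_sum_mult M K)
qed

lemma lev_coeff_0:
  assumes "\<And>i. coeff (s (Suc i)) 0 = s' (Suc i)"
  shows "coeff (lev s k j) 0 = lev s' k j"
proof (induction k arbitrary: j)
  case (Suc k)
  have c: "coeff (of_nat n * q) 0 = of_nat n * coeff q 0" for n and q :: "'a poly"
    by (simp add: of_nat_poly)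
  show ?case
    using Suc assms by (cases j) (simp_all only: lev.simps nat.case coeff_0_sum_mult
      mult_minus_left coeff_minus c)
qed simp

text \<open>The sum is its own negative; \<open>h\<close> is one half, which excludes
  2-torsion.\<close>

lemma sym_antisym_sum_eq_0:
  fixes S T :: "nat \<Rightarrow> nat \<Rightarrow> 'a::comm_ring_1"
  assumes S: "\<And>i k. i < N \<Longrightarrow> k < N \<Longrightarrow> S i k = S k i"
    and T: "\<And>i k. i < N \<Longrightarrow> k < N \<Longrightarrow> T i k = - T k i"
    and h: "h + h = (1::'a)"
  shows "(\<Sum>i<N. \<Sum>k<N. S i k * T k i) = 0" (is "?x = 0")
proof -
  have "?x = (\<Sum>i<N. \<Sum>k<N. - (S k i * T i k))"
    using S T by (intro sum.cong refl) (metis lessThan_iff mult_minus_right)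
  also have "\<dots> = - ?x" by (subst sum.swap) (simp add: sum_negf)
  finally have "?x + ?x = 0" by simp
  moreover have "(h + h) * ?x = h * (?x + ?x)" by (simp only: distrib_left distrib_right)
  ultimately have "(h + h) * ?x = 0" by (simp only: mult_zero_right)
  then show ?thesis unfolding h by simp
qed

text \<open>\<open>KK\<close> and \<open>LK\<close> record, within a commutative ring, that the
  entries of the odd row \<open>a\<close> anticommute in the intended \<open>K = b a\<close> and
  \<open>L = c a\<close>; \<open>GM\<close> and \<open>GK\<close> express orthosymplecticity.
  Deforming \<open>M\<close> to \<open>M + z g\<close> reaches the regular case, and at
  \<open>z = 0\<close> the vanishing supertraces reduce its identity to the leading term.\<close>

theorem blk_identity:
  fixes M K L G g :: "nat \<Rightarrow> nat \<Rightarrow> 'a::comm_ring_1"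
  assumes Gg: "\<And>i j. i < N \<Longrightarrow> j < N \<Longrightarrow> mm N G g i j = mid i j"
    and gG: "\<And>i j. i < N \<Longrightarrow> j < N \<Longrightarrow> mm N g G i j = mid i j"
    and GM: "\<And>i j. i < N \<Longrightarrow> j < N \<Longrightarrow> mm N G M i j = mm N G M j i"
    and GK: "\<And>i j. i < N \<Longrightarrow> j < N \<Longrightarrow> mm N G K i j = - mm N G K j i"
    and KK: "\<And>i j k l. i < N \<Longrightarrow> j < N \<Longrightarrow> k < N \<Longrightarrow> l < N \<Longrightarrow> K i j * K k l = - (K i l * K k j)"
    and LK: "\<And>i j k l. j < N \<Longrightarrow> k < N \<Longrightarrow> l < N \<Longrightarrow> L i j * K k l = - (L i l * K k j)"
    and str: "\<And>k. blk_str N M K (Suc k) = 0"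
    and h: "h + h = (1::'a)"
    and j: "j < N"
  shows "i < N \<Longrightarrow> of_nat (fact N) * blk N M K (Suc N) i j = 0"
    and "of_nat (fact N) * mm N L (blk N M K N) i j = 0"
proof -
  \<comment> \<open>\<open>M + z g\<close> and \<open>K\<close> over the polynomial ring in
    \<open>z\<close>, set to zero outside the index range because the regular case asks for
    equations of functions.\<close>
  define Mz where "Mz i j = (if i < N \<and> j < N then [:M i j, g i j:] else 0)" for i j
  define Kz where "Kz i j = (if i < N \<and> j < N then [:K i j:] else 0)" for i j
  define Lz where "Lz i j = [:L i j:]" for i j
  define Gz where "Gz i j = [:G i j:]" for i j
  \<comment> \<open>Since \<open>G g = I\<close>, the product \<open>G (M + z g) = z I + G M\<close>
    is the characteristic matrix of \<open>- G M\<close>; its determinant \<open>d\<close> is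
    monic.\<close>
  define F where "F = mat N N (\<lambda>(i, j). - mm N G M i j)"
  define C where "C = char_poly_matrix F"
  define d where "d = char_poly F"
  \<comment> \<open>\<open>adj (G (M + z g)) G\<close>, which acts as \<open>d\<close> times the
    inverse of \<open>M + z g\<close>.\<close>
  define W where "W i j = (if i < N \<and> j < N then \<Sum>k<N. adj_mat C $$ (i, k) * Gz k j else 0)" for i j
  have F: "F \<in> carrier_mat N N" by (simp add: F_def)
  then have C: "C \<in> carrier_mat N N" by (simp add: C_def)
  have monic: "degree d = N" "coeff d N = 1" using degree_monic_char_poly[OF F] by (simp_all add: d_def)
  have cancel: "p = 0" if "d ^ n * p = 0" for n p
    using that
  proof (induction n)
    case (Suc n)
    then have "d * (d ^ n * p) = 0" by (simp add: mult.assoc)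
    then show ?case using monic_mult_eq_0[of d] monic Suc.IH by metis
  qed simp
  have "C\<^sup>T = C"
    using F GM by (intro eq_matI) (auto simp: C_def char_poly_matrix_def F_def)
  then have adj_sym: "adj_mat C $$ (i, k) = adj_mat C $$ (k, i)" if "i < N" "k < N" for i k
    using adj_mat_symmetric[OF C] that by blast
  have Cadj: "(\<Sum>k<N. C $$ (i, k) * adj_mat C $$ (k, j)) = (if i = j then d else 0)"
    if "i < N" "j < N" for i j
  proof -
    have "(C * adj_mat C) $$ (i, j) = (\<Sum>k<N. C $$ (i, k) * adj_mat C $$ (k, j))"
      using C adj_mat(1)[OF C] that
      by (auto simp: times_mat_def scalar_prod_def atLeast0LessThan intro!: sum.cong)
    then show ?thesis using adj_mat(2)[OF C] that
      by (auto simp: d_def C_def char_poly_def split: if_splits)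
  qed
  have GMz: "(\<Sum>k<N. Gz i k * Mz k j) = C $$ (i, j)" if "i < N" "j < N" for i j
  proof -
    have "(\<Sum>k<N. Gz i k * Mz k j) = (\<Sum>k<N. [:G i k * M k j, G i k * g k j:])"
      using that by (intro sum.cong) (auto simp: Gz_def Mz_def)
    also have "\<dots> = [:mm N G M i j, mm N G g i j:]"
      by (simp add: poly_eq_iff coeff_sum mm_def coeff_pCons split: nat.split)
    finally show ?thesis
      using that F by (auto simp: C_def char_poly_matrix_def F_def Gg mid_def)
  qed
  have GW: "(\<Sum>k<N. Gz i k * (\<Sum>l<N. Mz k l * W l j)) = d * Gz i j" if "i < N" "j < N" for i j
  proof -
    have "(\<Sum>k<N. Gz i k * (\<Sum>l<N. Mz k l * W l j)) = (\<Sum>l<N. (\<Sum>k<N. Gz i k * Mz k l) * W l j)"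
      by (simp add: sum_distrib_left sum_distrib_right mult.assoc) (rule sum.swap)
    also have "\<dots> = (\<Sum>l<N. \<Sum>k<N. C $$ (i, l) * adj_mat C $$ (l, k) * Gz k j)"
      using that by (intro sum.cong refl) (simp add: GMz W_def sum_distrib_left mult.assoc)
    also have "\<dots> = (\<Sum>k<N. (\<Sum>l<N. C $$ (i, l) * adj_mat C $$ (l, k)) * Gz k j)"
      by (subst sum.swap) (simp add: sum_distrib_right)
    also have "\<dots> = (\<Sum>k<N. if i = k then d * Gz i j else 0)"
      using that Cadj by (intro sum.cong) auto
    finally show ?thesis using that by simp
  qed
  \<comment> \<open>Left multiplication of \<open>G (M + z g) W = d G\<close> by
    \<open>g\<close>.\<close>
  have MW: "(\<Sum>l<N. Mz r l * W l j) = (if r = j then d else 0)" if "r < N" "j < N" for r j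
  proof -
    have gGz: "(\<Sum>i<N. [:g r i:] * Gz i k) = (if r = k then 1 else 0)" if "k < N" for k
    proof -
      have "(\<Sum>i<N. [:g r i:] * Gz i k) = [:mm N g G r k:]"
        by (simp add: Gz_def mm_def poly_eq_iff coeff_sum coeff_pCons mult.commute split: nat.split)
      then show ?thesis using gG \<open>r < N\<close> that by (simp add: mid_def one_pCons)
    qed
    have "(\<Sum>l<N. Mz r l * W l j) = (\<Sum>k<N. if r = k then (\<Sum>l<N. Mz r l * W l j) else 0)"
      using that by simp
    also have "\<dots> = (\<Sum>k<N. (\<Sum>i<N. [:g r i:] * Gz i k) * (\<Sum>l<N. Mz k l * W l j))"
      using gGz by (intro sum.cong) auto
    also have "\<dots> = (\<Sum>i<N. [:g r i:] * (\<Sum>k<N. Gz i k * (\<Sum>l<N. Mz k l * W l j)))"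
      using fun_cong[OF fun_cong[OF mm_assoc[of N N "\<lambda>i j. [:g i j:]" Gz "mm N Mz W"], of r], of j]
      unfolding mm_def .
    also have "\<dots> = (\<Sum>i<N. d * ([:g r i:] * Gz i j))"
      using that GW by (intro sum.cong) (auto simp: mult.left_commute)
    also have "\<dots> = d * (\<Sum>i<N. [:g r i:] * Gz i j)" by (simp only: sum_distrib_left)
    finally show ?thesis using gGz[OF that(2)] by simp
  qed
  have MWK: "mm N Mz (mm N W Kz) = smul d Kz"
  proof (intro ext)
    fix i j
    have "mm N Mz (mm N W Kz) i j = (\<Sum>k<N. (\<Sum>l<N. Mz i l * W l k) * Kz k j)"
      unfolding mm_assoc[symmetric] by (simp add: mm_def)
    also have "\<dots> = d * Kz i j"
    proof (cases "i < N")
      case True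
      have "(\<Sum>k<N. (\<Sum>l<N. Mz i l * W l k) * Kz k j) = (\<Sum>k<N. if i = k then d * Kz i j else 0)"
        using True MW by (intro sum.cong) auto
      then show ?thesis using True by simp
    qed (simp add: Mz_def Kz_def)
    finally show "mm N Mz (mm N W Kz) i j = smul d Kz i j" by (simp add: smul_def)
  qed
  \<comment> \<open>\<open>tr (W K) = tr (adj C (G K))\<close> pairs a symmetric matrix with a skew
    one.\<close>
  have trWK: "tr N (mm N W Kz) = 0"
  proof -
    have "tr N (mm N W Kz) = (\<Sum>i<N. \<Sum>k<N. \<Sum>l<N. adj_mat C $$ (i, l) * (Gz l k * Kz k i))"
      unfolding tr_def mm_def by (intro sum.cong refl) (simp add: W_def sum_distrib_right mult.assoc)
    also have "\<dots> = (\<Sum>i<N. \<Sum>l<N. adj_mat C $$ (i, l) * mm N Gz Kz l i)"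
      unfolding mm_def sum_distrib_left by (intro sum.cong refl sum.swap)
    also have "\<dots> = 0"
    proof (rule sym_antisym_sum_eq_0[OF adj_sym])
      fix i k assume ik: "i < N" "k < N"
      have "mm N Gz Kz i k = [:mm N G K i k:]" if "i < N" "k < N" for i k
        using that by (simp add: mm_def Gz_def Kz_def poly_eq_iff coeff_sum coeff_pCons split: nat.split)
      then show "mm N Gz Kz i k = - mm N Gz Kz k i" using GK[OF ik] ik by simp
    next
      show "[:h:] + [:h:] = 1" using h by (simp add: one_pCons)
    qed
    finally show ?thesis .
  qed
  \<comment> \<open>Exchanging the column indices of \<open>A\<close> and \<open>K\<close> makes
    each entry of \<open>A W K\<close> equal to minus that of \<open>A\<close> times
    \<open>tr (W K)\<close>.\<close>
  have LWK: "mm N A (mm N W Kz) = 0"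
    if A: "\<And>i j k l. j < N \<Longrightarrow> k < N \<Longrightarrow> l < N \<Longrightarrow> A i j * Kz k l = - (A i l * Kz k j)" for A
  proof (intro ext)
    fix i l
    show "mm N A (mm N W Kz) i l = 0 i l"
    proof (cases "l < N")
      case True
      have "mm N A (mm N W Kz) i l = (\<Sum>j<N. \<Sum>k<N. W j k * (A i j * Kz k l))"
        unfolding mm_def sum_distrib_left by (intro sum.cong refl) (simp only: mult.left_commute)
      also have "\<dots> = (\<Sum>j<N. \<Sum>k<N. - A i l * (W j k * Kz k j))"
      proof (intro sum.cong refl)
        fix j k assume "j \<in> {..<N}" "k \<in> {..<N}"
        then have e: "A i j * Kz k l = - (A i l * Kz k j)" using A True by blast
        show "W j k * (A i j * Kz k l) = - A i l * (W j k * Kz k j)"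
          unfolding e by (simp add: mult.left_commute)
      qed
      also have "\<dots> = - A i l * tr N (mm N W Kz)"
        by (simp add: tr_def mm_def sum_distrib_left)
      finally show ?thesis using trWK by simp
    qed (simp add: mm_def Kz_def)
  qed
  have KWK: "mm N Kz (mm N W Kz) = 0"
  proof (rule LWK)
    fix i j k l assume jkl: "j < N" "k < N" "l < N"
    show "Kz i j * Kz k l = - (Kz i l * Kz k j)"
      using KK[OF _ jkl, of i] jkl by (auto simp: Kz_def mult.commute)
  qed
  have LzWK: "mm N Lz (mm N W Kz) = 0"
  proof (rule LWK)
    fix i j k l assume jkl: "j < N" "k < N" "l < N"
    show "Lz i j * Kz k l = - (Lz i l * Kz k j)"
      using LK[OF jkl, of i] jkl by (simp add: Lz_def Kz_def mult.commute)
  qed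
  have c0: "coeff (Mz i j) 0 = M i j" "coeff (Kz i j) 0 = K i j" if "i < N" "j < N" for i j
    using that by (simp_all add: Mz_def Kz_def)
  have Y0: "coeff (blk N Mz Kz k i j) 0 = blk N M K k i j" if "i < N" "j < N" for k i j
    using blk_coeff_0[of N Mz M Kz K] c0 that by blast
  have s0: "coeff (blk_str N Mz Kz (Suc k)) 0 = 0" for k
  proof -
    have "coeff (tr N (blk N Mz Kz k)) 0 = tr N (blk N M K k)" for k
      by (simp add: tr_def coeff_sum Y0)
    moreover have "coeff (tr N (mm N Kz (blk N Mz Kz k))) 0 = tr N (mm N K (blk N M K k))" for k
      by (simp add: tr_def mm_def coeff_sum coeff_mult_0 Y0 c0)
    ultimately have "coeff (blk_str N Mz Kz (Suc k)) 0 = blk_str N M K (Suc k)"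
      by (simp add: blk_str_def)
    then show ?thesis using str by simp
  qed
  \<comment> \<open>The power of the monic \<open>d\<close> cancels; at \<open>z = 0\<close> the
    supertraces vanish, and of the coefficients \<open>lev\<close> only the top one,
    \<open>N!\<close> up to sign, survives.\<close>
  have top_term: "of_nat (fact N) * (coeff (f N) 0) = 0"
    if "d ^ N * (\<Sum>l\<le>N. lev (blk_str N Mz Kz) N l * f l) = 0" for f
  proof -
    have "0 = coeff (\<Sum>l\<le>N. lev (blk_str N Mz Kz) N l * f l) 0" using cancel[OF that] by simp
    also have "\<dots> = (\<Sum>l\<le>N. (if l = N then (-1) ^ N * of_nat (fact N) else 0) * coeff (f l) 0)"
      unfolding coeff_0_sum_mult
      using lev_coeff_0[of "blk_str N Mz Kz" "\<lambda>_. 0", OF s0] lev_zero[of "\<lambda>_. 0 :: 'a"]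
      by (intro sum.cong refl) simp
    also have "\<dots> = (\<Sum>l\<le>N. if l = N then (-1) ^ N * of_nat (fact N) * coeff (f l) 0 else 0)"
      by (intro sum.cong) auto
    finally have "(-1) ^ N * (of_nat (fact N) * coeff (f N) 0) = 0" by (simp add: mult.assoc)
    then have "(-1) ^ N * ((-1) ^ N * (of_nat (fact N) * coeff (f N) 0)) = 0" by (simp only: mult_zero_right)
    then show ?thesis by (simp only: mult.assoc[symmetric] power_add[symmetric])
        (simp add: mult.assoc)
  qed
  show "of_nat (fact N) * blk N M K (Suc N) i j = 0" if "i < N"
    using top_term[OF blk_identity_regular(1)[OF MWK KWK LzWK trWK j], of i] Y0[OF that j] by simp
  show "of_nat (fact N) * mm N L (blk N M K N) i j = 0"
    using top_term[OF blk_identity_regular(2)[OF MWK KWK LzWK trWK j], of i] j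
    by (simp add: mm_def coeff_sum Y0 Lz_def)
qed

section \<open>Generators with prescribed commutation signs\<close>

text \<open>Linear maps on complex functions of sets of generator indices. In this model the ring
  laws come from composition, and relations between generators are checked on functions.\<close>

typedef oper = "{T :: (nat set \<Rightarrow> complex) \<Rightarrow> nat set \<Rightarrow> complex.
    (\<forall>f g. T (\<lambda>A. f A + g A) = (\<lambda>A. T f A + T g A)) \<and> (\<forall>c f. T (\<lambda>A. c * f A) = (\<lambda>A. c * T f A))}"
  morphisms app Oper
  by (rule exI[of _ "\<lambda>f. f"]) simp

setup_lifting type_definition_oper

instantiation oper :: ring_1
begin

lift_definition zero_oper :: oper is "\<lambda>f A. 0" by simp
lift_definition one_oper :: oper is "\<lambda>f. f" by simp
lift_definition plus_oper :: "oper \<Rightarrow> oper \<Rightarrow> oper" is "\<lambda>T U f A. T f A + U f A"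
  by (auto simp: algebra_simps fun_eq_iff)
lift_definition minus_oper :: "oper \<Rightarrow> oper \<Rightarrow> oper" is "\<lambda>T U f A. T f A - U f A"
  by (auto simp: algebra_simps fun_eq_iff)
lift_definition uminus_oper :: "oper \<Rightarrow> oper" is "\<lambda>T f A. - T f A"
  by (auto simp: algebra_simps fun_eq_iff)
lift_definition times_oper :: "oper \<Rightarrow> oper \<Rightarrow> oper" is "\<lambda>T U f. T (U f)"
  by simp

instance
proof
  fix a b c :: oper
  show "0 \<noteq> (1 :: oper)" by transfer (metis zero_neq_one)
qed (transfer; simp add: fun_eq_iff algebra_simps)+

end

section \<open>Scalars, creation operators and their commutation signs\<close>

lift_definition scal :: "complex \<Rightarrow> oper" is "\<lambda>c f A. c * f A"
  by (auto simp: algebra_simps fun_eq_iff)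

text \<open>Generators of even index stand for even \<open>X\<^sub>k\<close>, those of odd index for odd \<open>X\<^sub>k\<close>. They are realised
  as creation operators on functions of finite sets, so that coefficients are read off by applying an
  operator to the vacuum, the indicator of the empty set.\<close>

definition csg :: "nat \<Rightarrow> nat \<Rightarrow> complex" where
  "csg j k = (if odd j \<and> odd k then 1 else -1)"

text \<open>The sign for moving \<open>theta k\<close> to its place in the increasing product over
  \<open>A\<close>; only finitely many indices lie below \<open>k\<close>, even if \<open>A\<close>
  is infinite.\<close>

definition past :: "nat \<Rightarrow> nat set \<Rightarrow> complex" where
  "past k A = (\<Prod>j\<in>{j \<in> A. j < k}. csg j k)"

lift_definition theta :: "nat \<Rightarrow> oper" is
  "\<lambda>k f A. if k \<in> A then past k A * f (A - {k}) else 0"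
  by (auto simp: algebra_simps fun_eq_iff)

lemma scal_add: "scal (a + b) = scal a + scal b"
  by transfer (simp add: fun_eq_iff algebra_simps)

lemma scal_mult: "scal (a * b) = scal a * scal b"
  by transfer (simp add: fun_eq_iff algebra_simps)

lemma scal_minus: "scal (- a) = - scal a"
  by transfer (simp add: fun_eq_iff)

lemma scal_0: "scal 0 = 0" and scal_1: "scal 1 = 1"
  by (transfer; simp)+

lemma scal_sum: "scal (sum f A) = (\<Sum>x\<in>A. scal (f x))"
  by (induction A rule: infinite_finite_induct) (simp_all add: scal_0 scal_add)

lemma scal_of_nat: "scal (of_nat n) = of_nat n"
  by (induction n) (simp_all add: scal_0 scal_1 scal_add)

lemma scal_commute: "T * scal c = scal c * T"
  by transfer (simp add: fun_eq_iff)

lemma past_remove: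
  assumes "j \<in> A" "j < k"
  shows "past k A = csg j k * past k (A - {j})"
proof -
  have "{i \<in> A. i < k} = insert j {i \<in> A - {j}. i < k}" using assms by auto
  then show ?thesis by (simp add: past_def)
qed

lemma past_remove_greater:
  assumes "k < j"
  shows "past k (A - {j}) = past k A"
  unfolding past_def using assms by (intro prod.cong) auto

text \<open>This includes the generators of odd index, which commute with each other; only
  coefficients of products of distinct generators are wanted.\<close>

lemma theta_sq: "theta k * theta k = 0"
  by transfer (simp add: fun_eq_iff)

lemma theta_commute_less:
  assumes "j < k"
  shows "theta j * theta k = scal (csg j k) * (theta k * theta j)"
    and "theta k * theta j = scal (csg j k) * (theta j * theta k)"
proof -
  show 1: "theta j * theta k = scal (csg j k) * (theta k * theta j)"
    using assms
    by transfer (auto simp: fun_eq_iff past_remove past_remove_greater csg_def insert_commute Diff_insert2[symmetric])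
  show "theta k * theta j = scal (csg j k) * (theta j * theta k)"
    unfolding 1 mult.assoc[symmetric] scal_mult[symmetric] by (simp add: csg_def scal_1)
qed

lemma theta_commute:
  "theta j * theta k = (if odd j \<and> odd k then theta k * theta j else - (theta k * theta j))"
proof (cases j k rule: linorder_cases)
  case less
  then show ?thesis by (simp add: theta_commute_less(1)[OF less] csg_def scal_1 scal_minus)
next
  case equal
  then show ?thesis by (simp add: theta_sq)
next
  case greater
  then show ?thesis by (simp add: theta_commute_less(2)[OF greater] csg_def scal_1 scal_minus)
qed

text \<open>\<open>swp m q T\<close>: moving a generator past \<open>T\<close> costs the sign \<open>(-1)^m\<close> for the generators
  of even index and \<open>(-1)^q\<close> for those of odd index.\<close>

definition swp :: "nat \<Rightarrow> nat \<Rightarrow> oper \<Rightarrow> bool" where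
  "swp m q T \<longleftrightarrow> (\<forall>k. theta k * T = (-1) ^ (if odd k then q else m) * (T * theta k))"

lemma minus_one_power_commute: "(x :: 'a::ring_1) * (-1) ^ n = (-1) ^ n * x"
  by (simp add: minus_one_power_iff)

lemma swp_parity: "swp m q T \<Longrightarrow> even (m + m') \<Longrightarrow> even (q + q') \<Longrightarrow> swp m' q' T"
  unfolding swp_def minus_one_power_iff by (auto split: if_splits)

text \<open>So, modulo 2, \<open>m\<close> counts all generators in a product and \<open>q\<close>
  those of even index.\<close>

lemma swp_theta: "swp 1 (if odd k then 0 else 1) (theta k)"
  unfolding swp_def using theta_commute[of _ k] by auto

lemma swp_mult:
  assumes "swp m q T" "swp m' q' U"
  shows "swp (m + m') (q + q') (T * U)"
  unfolding swp_def
proof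
  fix k :: nat
  let ?a = "if odd k then q else m" and ?b = "if odd k then q' else m'"
  have "theta k * (T * U) = ((-1) ^ ?a * (T * theta k)) * U"
    using assms(1) by (simp add: swp_def mult.assoc[symmetric])
  also have "\<dots> = (-1) ^ ?a * (T * ((-1) ^ ?b * (U * theta k)))"
    using assms(2) by (simp add: swp_def mult.assoc)
  also have "\<dots> = ((-1) ^ ?a * (-1) ^ ?b) * (T * U * theta k)"
    by (simp add: minus_one_power_iff mult.assoc)
  finally show "theta k * (T * U) = (-1) ^ (if odd k then q + q' else m + m') * (T * U * theta k)"
    by (simp add: power_add)
qed

lemma swp_0_0_mult: "swp 0 0 T \<Longrightarrow> swp 0 0 U \<Longrightarrow> swp 0 0 (T * U)"
  using swp_mult[of 0 0 T 0 0 U] by simp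

lemma swp_add: "swp m q T \<Longrightarrow> swp m q U \<Longrightarrow> swp m q (T + U)"
  by (simp add: swp_def algebra_simps)

lemma swp_minus: "swp m q T \<Longrightarrow> swp m q (- T)"
  by (simp add: swp_def)

lemma swp_diff: "swp m q T \<Longrightarrow> swp m q U \<Longrightarrow> swp m q (T - U)"
  using swp_add[of m q T "- U"] swp_minus[of m q U] by simp

lemma swp_scal: "swp 0 0 (scal c)"
  by (simp add: swp_def scal_commute)

lemma swp_0: "swp m q 0" and swp_1: "swp 0 0 1"
  by (simp_all add: swp_def)

lemma swp_sum: "(\<And>x. x \<in> A \<Longrightarrow> swp m q (f x)) \<Longrightarrow> swp m q (sum f A)"
  by (induction A rule: infinite_finite_induct) (simp_all add: swp_0 swp_add)

text \<open>The bicommutant of the generators: it contains them, and its elements that commute with all of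
  them form the commutative ring \<open>ev\<close> below, over which determinants are available.\<close>

definition alg :: "oper set" where
  "alg = {T. \<forall>U. (\<forall>k. U * theta k = theta k * U) \<longrightarrow> T * U = U * T}"

text \<open>The signs (0, 0) in \<open>swp\<close> mean commuting with every generator; this is the
  source of commutativity of \<open>ev\<close>.\<close>

lemma alg_commute:
  assumes T: "T \<in> alg" and U: "swp 0 0 U"
  shows "T * U = U * T"
proof -
  have "U * theta k = theta k * U" for k
    using spec[OF U[unfolded swp_def], of k] by (cases "odd k") auto
  then show ?thesis using T unfolding alg_def by blast
qed

lemma alg_theta: "theta k \<in> alg"
  by (simp add: alg_def)

lemma alg_scal: "scal c \<in> alg"
  by (simp add: alg_def scal_commute)

lemma alg_0: "0 \<in> alg" and alg_1: "1 \<in> alg"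
  by (simp_all add: alg_def)

lemma alg_add: "T \<in> alg \<Longrightarrow> U \<in> alg \<Longrightarrow> T + U \<in> alg"
  by (simp add: alg_def algebra_simps)

lemma alg_minus: "T \<in> alg \<Longrightarrow> - T \<in> alg"
  by (simp add: alg_def)

lemma alg_diff: "T \<in> alg \<Longrightarrow> U \<in> alg \<Longrightarrow> T - U \<in> alg"
  using alg_add[of T "- U"] alg_minus[of U] by simp

lemma alg_mult:
  assumes T: "T \<in> alg" and U: "U \<in> alg"
  shows "T * U \<in> alg"
  unfolding alg_def
proof (intro CollectI allI impI)
  fix V assume V: "\<forall>k. V * theta k = theta k * V"
  have TV: "T * V = V * T" and UV: "U * V = V * U" using T U V unfolding alg_def by blast+
  have "T * U * V = T * V * U" by (simp only: UV mult.assoc)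
  also have "\<dots> = V * (T * U)" by (simp only: TV mult.assoc)
  finally show "T * U * V = V * (T * U)" .
qed

lemma alg_sum: "(\<And>x. x \<in> A \<Longrightarrow> f x \<in> alg) \<Longrightarrow> sum f A \<in> alg"
  by (induction A rule: infinite_finite_induct) (simp_all add: alg_0 alg_add)

section \<open>The commutative ring of even elements\<close>

typedef ev = "{T \<in> alg. swp 0 0 T}"
  morphisms opr Ev
  by (rule exI[of _ 0]) (simp add: alg_0 swp_0)

setup_lifting type_definition_ev

instantiation ev :: comm_ring_1
begin

lift_definition zero_ev :: ev is 0 by (simp add: alg_0 swp_0)
lift_definition one_ev :: ev is 1 by (simp add: alg_1 swp_1)
lift_definition plus_ev :: "ev \<Rightarrow> ev \<Rightarrow> ev" is "(+)" by (simp add: alg_add swp_add)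
lift_definition uminus_ev :: "ev \<Rightarrow> ev" is uminus by (simp add: alg_minus swp_minus)
lift_definition minus_ev :: "ev \<Rightarrow> ev \<Rightarrow> ev" is "(-)"
  by (simp add: alg_diff swp_diff)
lift_definition times_ev :: "ev \<Rightarrow> ev \<Rightarrow> ev" is "(*)"
  by (simp add: alg_mult swp_0_0_mult)

instance
proof
  fix a b c :: ev
  show "a * b = b * a" by transfer (blast intro: alg_commute)
  show "a * b * c = a * (b * c)" by transfer (simp add: mult.assoc)
  show "1 * a = a" by transfer simp
  show "(a + b) * c = a * c + b * c" by transfer (simp add: distrib_right)
  show "a + b + c = a + (b + c)" by transfer (simp add: add.assoc)
  show "a + b = b + a" by transfer (simp add: add.commute)
  show "0 + a = a" by transfer simp
  show "- a + a = 0" by transfer simp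
  show "a - b = a + - b" by transfer simp
  show "0 \<noteq> (1 :: ev)" by transfer simp
qed

end

lemma opr_sum: "opr (sum f A) = (\<Sum>x\<in>A. opr (f x))"
  by (induction A rule: infinite_finite_induct) (simp_all add: zero_ev.rep_eq plus_ev.rep_eq)

lemma opr_mm: "opr (mm N A B i j) = mm N (\<lambda>i j. opr (A i j)) (\<lambda>i j. opr (B i j)) i j"
  by (simp add: mm_def opr_sum times_ev.rep_eq)

lemma opr_blk:
  "opr (blk N M K k i j) = blk N (\<lambda>i j. opr (M i j)) (\<lambda>i j. opr (K i j)) k i j"
proof (induction k arbitrary: i rule: induct_nat_012)
  case 0
  then show ?case by (simp add: mid_def zero_ev.rep_eq one_ev.rep_eq)
next
  case 1
  have "(\<lambda>i j. opr (mid i j)) = mid"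
    by (simp add: fun_eq_iff mid_def zero_ev.rep_eq one_ev.rep_eq)
  then show ?case by (simp add: opr_mm)
next
  case (ge2 k)
  then show ?case
    by (simp add: blk_Suc_Suc plus_ev.rep_eq opr_mm) (simp add: mm_def)
qed

lemma opr_of_nat: "opr (of_nat n) = of_nat n"
  by (induction n) (simp_all add: zero_ev.rep_eq one_ev.rep_eq plus_ev.rep_eq)

section \<open>Coefficients at the vacuum\<close>

lift_definition vac_coeff :: "oper \<Rightarrow> nat set \<Rightarrow> complex" is
  "\<lambda>T. T (\<lambda>A. if A = {} then 1 else 0)" .

lemma vac_coeff_0: "vac_coeff 0 S = 0"
  by transfer simp

lemma vac_coeff_add: "vac_coeff (T + U) S = vac_coeff T S + vac_coeff U S"
  by transfer simp

lemma vac_coeff_sum: "vac_coeff (sum f A) S = (\<Sum>x\<in>A. vac_coeff (f x) S)"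
  by (induction A rule: infinite_finite_induct) (simp_all add: vac_coeff_0 vac_coeff_add)

lemma vac_coeff_scal: "vac_coeff (scal c * T) S = c * vac_coeff T S"
  by transfer simp

lemma vac_coeff_1: "vac_coeff 1 S = (if S = {} then 1 else 0)"
  by transfer simp

lemma vac_coeff_theta:
  "vac_coeff (theta k * T) S = (if k \<in> S then past k S * vac_coeff T (S - {k}) else 0)"
  by transfer simp

lemma past_nonzero: "past k A \<noteq> 0"
  by (simp add: past_def csg_def)

text \<open>Creating two generators outside \<open>S\<close> moves the coefficient at
  \<open>S\<close> to the enlarged set and changes it by a nonzero factor only.\<close>

lemma vac_coeff_fresh:
  assumes "theta a * (theta b * T) = 0" "a \<noteq> b" "a \<notin> S" "b \<notin> S"
  shows "vac_coeff T S = 0"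
proof -
  have "vac_coeff (theta a * (theta b * T)) (insert a (insert b S)) = 0"
    by (simp add: assms(1) vac_coeff_0)
  then show ?thesis using assms(2-4) past_nonzero by (simp add: vac_coeff_theta insert_Diff_if)
qed

text \<open>The sign of sorting a word of distinct letters: each letter passes the smaller ones to
  its right.\<close>

primrec word_sign :: "nat list \<Rightarrow> complex" where
  "word_sign [] = 1"
| "word_sign (k # ks) = past k (set (k # ks)) * word_sign ks"

lemma vac_coeff_word:
  "vac_coeff (prod_list (map theta ks)) S = (if distinct ks \<and> set ks = S then word_sign ks else 0)"
proof (induction ks arbitrary: S)
  case Nil
  then show ?case by (auto simp: vac_coeff_1)
next
  case (Cons k ks)
  have "k \<in> S \<Longrightarrow> set ks = S - {k} \<and> distinct ks \<longleftrightarrow> insert k (set ks) = S \<and> k \<notin> set ks \<and> distinct ks"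
    by auto
  then show ?case using Cons[of "S - {k}"] by (auto simp: vac_coeff_theta)
qed

section \<open>The alternating sum as a coefficient of a power\<close>

definition vsign :: "nat \<Rightarrow> (nat \<Rightarrow> nat) \<Rightarrow> int" where
  "vsign m \<sigma> = (\<Prod>(i, j)\<in>{(i, j). i < j \<and> j < m}. sgn (int (\<sigma> j) - int (\<sigma> i)))"

lemma finite_pairs: "finite {(i, j). i < j \<and> j < (m :: nat)}"
  by (rule finite_subset[of _ "{..<m} \<times> {..<m}"]) auto

text \<open>A permutation acts on unordered pairs, represented here by their smaller and larger
  element.\<close>

lemma prod_pairs_reindex:
  fixes g :: "nat \<Rightarrow> nat \<Rightarrow> 'a::comm_monoid_mult"
  assumes \<sigma>: "\<sigma> permutes {0..<m}" and sym: "\<And>x y. g x y = g y x"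
  shows "(\<Prod>(i, j)\<in>{(i, j). i < j \<and> j < m}. g (\<sigma> i) (\<sigma> j)) = (\<Prod>(i, j)\<in>{(i, j). i < j \<and> j < m}. g i j)"
proof -
  let ?A = "{(i, j). i < j \<and> j < m}"
  define h where "h = (\<lambda>(i, j). (min (\<sigma> i) (\<sigma> j), max (\<sigma> i) (\<sigma> j)))"
  have inj: "\<sigma> a = \<sigma> b \<longleftrightarrow> a = b" for a b using permutes_inj[OF \<sigma>] by (auto dest: injD)
  have lt: "\<sigma> a < m \<longleftrightarrow> a < m" for a using permutes_in_image[OF \<sigma>, of a] by simp
  have "inj_on h ?A"
    by (rule inj_onI) (auto simp: h_def min_def max_def inj split: if_splits)
  moreover have "h ` ?A \<subseteq> ?A"
  proof (rule image_subsetI)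
    fix x assume "x \<in> ?A"
    then obtain i j where x: "x = (i, j)" and "i < j" "j < m" by blast
    then have "\<sigma> i \<noteq> \<sigma> j" "\<sigma> i < m" "\<sigma> j < m" using inj lt by auto
    then show "h x \<in> ?A" by (auto simp: x h_def)
  qed
  ultimately have h: "inj_on h ?A" "h ` ?A = ?A"
    using endo_inj_surj[OF finite_pairs[of m], of h] by blast+
  have "prod (case_prod g) ?A = prod (case_prod g) (h ` ?A)" by (simp only: h(2))
  also have "\<dots> = prod (case_prod g \<circ> h) ?A" by (rule prod.reindex[OF h(1)])
  also have "\<dots> = (\<Prod>(i, j)\<in>?A. g (\<sigma> i) (\<sigma> j))"
    by (rule prod.cong) (auto simp: h_def min_def max_def sym)
  finally show ?thesis by simp
qed

text \<open>The signs of \<open>\<tau> y - \<tau> x\<close> and of \<open>y - x\<close> are skew in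
  \<open>x\<close> and \<open>y\<close>, so their product is symmetric and may be reindexed by
  \<open>\<sigma>\<close>.\<close>

lemma vsign_comp:
  assumes \<sigma>: "\<sigma> permutes {0..<m}" and \<tau>: "\<tau> permutes {0..<m}"
  shows "vsign m (\<tau> \<circ> \<sigma>) = vsign m \<tau> * vsign m \<sigma>"
proof -
  let ?A = "{(i, j). i < j \<and> j < m}"
  define g where "g x y = sgn (int (\<tau> y) - int (\<tau> x)) * sgn (int y - int x)" for x y
  have inj: "\<sigma> a = \<sigma> b \<longleftrightarrow> a = b" for a b using permutes_inj[OF \<sigma>] by (auto dest: injD)
  have sym: "g x y = g y x" for x y
    by (auto simp: g_def sgn_if)
  have "vsign m (\<tau> \<circ> \<sigma>) = (\<Prod>(i, j)\<in>?A. g (\<sigma> i) (\<sigma> j) * sgn (int (\<sigma> j) - int (\<sigma> i)))"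
    unfolding vsign_def by (rule prod.cong) (auto simp: g_def sgn_if inj)
  also have "\<dots> = (\<Prod>(i, j)\<in>?A. g (\<sigma> i) (\<sigma> j)) * vsign m \<sigma>"
    unfolding vsign_def by (simp add: prod.distrib[symmetric] case_prod_beta)
  also have "(\<Prod>(i, j)\<in>?A. g (\<sigma> i) (\<sigma> j)) = (\<Prod>(i, j)\<in>?A. g i j)"
    using prod_pairs_reindex[OF \<sigma>, of g] sym by simp
  also have "\<dots> = vsign m \<tau>"
    unfolding vsign_def g_def by (rule prod.cong) auto
  finally show ?thesis .
qed

lemma prod_if_const:
  "finite A \<Longrightarrow> (\<Prod>x\<in>A. if P x then c else (1 :: 'a::comm_monoid_mult)) = c ^ card {x \<in> A. P x}"
  by (simp add: prod.inter_filter[symmetric])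

lemma vsign_inversions:
  assumes "inj \<sigma>"
  shows "vsign m \<sigma> = (-1) ^ card {(i, j). i < j \<and> j < m \<and> \<sigma> j < \<sigma> i}"
proof -
  have "vsign m \<sigma> = (\<Prod>x\<in>{(i, j). i < j \<and> j < m}. if \<sigma> (snd x) < \<sigma> (fst x) then - 1 else 1)"
    unfolding vsign_def
    by (rule prod.cong) (auto simp: sgn_if dest: injD[OF assms])
  also have "\<dots> = (-1) ^ card {x \<in> {(i, j). i < j \<and> j < m}. \<sigma> (snd x) < \<sigma> (fst x)}"
    by (rule prod_if_const[OF finite_pairs])
  also have "{x \<in> {(i, j). i < j \<and> j < m}. \<sigma> (snd x) < \<sigma> (fst x)} = {(i, j). i < j \<and> j < m \<and> \<sigma> j < \<sigma> i}"
    by auto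
  finally show ?thesis .
qed

text \<open>The inversions are the pairs (a, j) with a < j \<le> b and (i, b) with a < i < b, an odd
  number in all.\<close>

lemma vsign_transpose:
  assumes "a < b" "b < m"
  shows "vsign m (transpose a b) = -1"
proof -
  have "{(i, j). i < j \<and> j < m \<and> transpose a b j < transpose a b i}
      = Pair a ` {a<..b} \<union> (\<lambda>i. (i, b)) ` {a<..<b}"
    using assms by (auto simp: transpose_def split: if_splits)
  also have "card \<dots> = (b - a) + (b - a - 1)"
    by (subst card_Un_disjoint) (auto simp: card_image inj_on_def)
  also have "odd \<dots>" using assms by presburger
  finally show ?thesis by (simp add: vsign_inversions)
qed

text \<open>Both sides are multiplicative and agree on transpositions.\<close>

lemma sign_eq_vsign:
  assumes "\<sigma> permutes {0..<m}"
  shows "sign \<sigma> = vsign m \<sigma>"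
  using assms
proof (rule permutes_induct)
  show "finite {0..<m}" by simp
next
  have "vsign m id = 1" unfolding vsign_def by (rule prod.neutral) auto
  then show "sign id = vsign m id" by (simp add: sign_id)
next
  fix a b p
  assume 2: "a \<in> {0..<m}" "b \<in> {0..<m}" "a \<noteq> b" "sign p = vsign m p" "p permutes {0..<m}"
  have t: "transpose a b permutes {0..<m}" using 2 by (intro permutes_swap_id)
  have s: "sign (transpose a b \<circ> p) = sign (transpose a b) * sign p"
    using 2 t by (intro sign_compose) (auto simp: permutation_permutes)
  have "sign (transpose a b) = vsign m (transpose a b)"
  proof (cases a b rule: linorder_cases)
    case less
    then show ?thesis using 2 by (simp add: vsign_transpose sign_swap_id)
  next
    case equal
    then show ?thesis using 2 by simp
  next
    case greater
    then show ?thesis using 2 vsign_transpose[of b a m] by (simp add: sign_swap_id transpose_commute)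
  qed
  then show "sign (transpose a b \<circ> p) = vsign m (transpose a b \<circ> p)" using 2 s vsign_comp[OF _ t, of p] by simp
qed

lemma word_sign_map:
  assumes "inj_on f {a..<m}"
  shows "word_sign (map f [a..<m]) = (\<Prod>i\<in>{a..<m}. \<Prod>j\<in>{j. i < j \<and> j < m \<and> f j < f i}. csg (f j) (f i))"
  using assms
proof (induction "m - a" arbitrary: a)
  case 0
  then show ?case by simp
next
  case (Suc d)
  then have a: "a < m" by simp
  have sub: "inj_on f {Suc a..<m}" using Suc.prems by (rule inj_on_subset) auto
  have "past (f a) (f ` {a..<m}) = (\<Prod>x\<in>f ` {j. a < j \<and> j < m \<and> f j < f a}. csg x (f a))"
    unfolding past_def
  proof (rule prod.cong)
    show "{x \<in> f ` {a..<m}. x < f a} = f ` {j. a < j \<and> j < m \<and> f j < f a}"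
    proof (intro equalityI subsetI)
      fix x assume "x \<in> {x \<in> f ` {a..<m}. x < f a}"
      then obtain j where "x = f j" "a \<le> j" "j < m" "f j < f a" by auto
      moreover from this have "j \<noteq> a" by auto
      ultimately show "x \<in> f ` {j. a < j \<and> j < m \<and> f j < f a}" by auto
    qed auto
  qed simp
  also have "\<dots> = (\<Prod>j\<in>{j. a < j \<and> j < m \<and> f j < f a}. csg (f j) (f a))"
    by (rule prod.reindex_cong[where l = f]) (use Suc.prems in \<open>auto intro: inj_on_subset\<close>)
  finally have p: "past (f a) (f ` {a..<m}) = \<dots>" .
  have "word_sign (map f [a..<m]) = past (f a) (f ` {a..<m}) * word_sign (map f [Suc a..<m])"
  proof -
    have "set (f a # map f [Suc a..<m]) = f ` {a..<m}"
      using a by (metis list.simps(9) set_map set_upt upt_conv_Cons)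
    then show ?thesis by (simp only: upt_conv_Cons[OF a] list.map word_sign.simps)
  qed
  also have "word_sign (map f [Suc a..<m]) = (\<Prod>i\<in>{Suc a..<m}. \<Prod>j\<in>{j. i < j \<and> j < m \<and> f j < f i}. csg (f j) (f i))"
    using Suc.hyps(1)[of "Suc a"] Suc.hyps(2) sub by simp
  finally show ?case using a p by (simp add: prod.atLeast_Suc_lessThan)
qed

text \<open>The parity of the index encodes that of \<open>X k\<close>, and the order of the
  arguments is kept, so the inversions of a word are those of the permutation.\<close>

definition gen :: "(nat \<Rightarrow> bool) \<Rightarrow> nat \<Rightarrow> nat" where
  "gen p k = 2 * k + (if p k then 1 else 0)"

lemma gen_less: "gen p j < gen p k \<longleftrightarrow> j < k"
  by (auto simp: gen_def less_Suc_eq)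

lemma inj_gen: "inj (gen p)"
  by (rule injI) (metis gen_less nat_neq_iff)

lemma odd_gen: "odd (gen p k) \<longleftrightarrow> p k"
  by (simp add: gen_def)

text \<open>Every inversion contributes \<open>-1\<close>, and a second \<open>-1\<close> if both
  arguments are odd, since then the two generators commute.\<close>

lemma word_sign_permutation:
  assumes \<sigma>: "\<sigma> permutes {0..<m}"
  shows "word_sign (map (gen p) (map \<sigma> [0..<m])) = of_int (sign \<sigma>) * (-1) ^ Kinv m \<sigma> p"
proof -
  let ?I = "{(i, j). i < j \<and> j < m \<and> \<sigma> j < \<sigma> i}"
  have inj: "inj (gen p \<circ> \<sigma>)" using inj_gen permutes_inj[OF \<sigma>] by (rule inj_compose)
  have fin: "finite ?I" by (rule finite_subset[OF _ finite_pairs[of m]]) auto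
  have "word_sign (map (gen p) (map \<sigma> [0..<m])) = word_sign (map (gen p \<circ> \<sigma>) [0..<m])" by simp
  also have "\<dots> = (\<Prod>i\<in>{0..<m}. \<Prod>j\<in>{j. i < j \<and> j < m \<and> \<sigma> j < \<sigma> i}. csg (gen p (\<sigma> j)) (gen p (\<sigma> i)))"
    by (subst word_sign_map) (use inj in \<open>auto simp: gen_less intro: inj_on_subset\<close>)
  also have "\<dots> = (\<Prod>(i, j)\<in>(SIGMA i:{0..<m}. {j. i < j \<and> j < m \<and> \<sigma> j < \<sigma> i}). csg (gen p (\<sigma> j)) (gen p (\<sigma> i)))"
    by (rule prod.Sigma) auto
  also have "(SIGMA i:{0..<m}. {j. i < j \<and> j < m \<and> \<sigma> j < \<sigma> i}) = ?I" by auto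
  also have "(\<Prod>(i, j)\<in>?I. csg (gen p (\<sigma> j)) (gen p (\<sigma> i)))
      = (\<Prod>x\<in>?I. (- 1) * (if p (\<sigma> (fst x)) \<and> p (\<sigma> (snd x)) then - 1 else 1))"
    by (rule prod.cong) (auto simp: csg_def odd_gen)
  also have "\<dots> = (\<Prod>x\<in>?I. - 1) * (\<Prod>x\<in>?I. if p (\<sigma> (fst x)) \<and> p (\<sigma> (snd x)) then - 1 else 1)"
    by (rule prod.distrib)
  also have "(\<Prod>x\<in>?I. - 1 :: complex) = (-1) ^ card ?I" by simp
  also have "(\<Prod>x\<in>?I. if p (\<sigma> (fst x)) \<and> p (\<sigma> (snd x)) then - 1 else 1 :: complex)
      = (-1) ^ card {x \<in> ?I. p (\<sigma> (fst x)) \<and> p (\<sigma> (snd x))}"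
    by (rule prod_if_const[OF fin])
  also have "{x \<in> ?I. p (\<sigma> (fst x)) \<and> p (\<sigma> (snd x))}
      = {(i, j). i < j \<and> j < m \<and> \<sigma> i > \<sigma> j \<and> p (\<sigma> i) \<and> p (\<sigma> j)}" by auto
  also have "(-1 :: complex) ^ card ?I = of_int (sign \<sigma>)"
    unfolding sign_eq_vsign[OF \<sigma>] vsign_inversions[OF permutes_inj[OF \<sigma>]] by simp
  finally show ?thesis by (simp add: Kinv_def)
qed

section \<open>Expansion of the powers of \<Theta> into words\<close>

definition generic :: "nat \<Rightarrow> (nat \<Rightarrow> mat) \<Rightarrow> (nat \<Rightarrow> bool) \<Rightarrow> nat \<Rightarrow> nat \<Rightarrow> oper" where
  "generic m X p = (\<lambda>i j. \<Sum>k<m. scal (X k i j) * theta (gen p k))"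

lemma mpow_generic:
  "i < N \<Longrightarrow> mpow N (generic m X p) L i j =
    (\<Sum>ks\<in>{ks. set ks \<subseteq> {..<m} \<and> length ks = L}.
      scal (mprod N (map X ks) i j) * prod_list (map theta (map (gen p) ks)))"
proof (induction L arbitrary: i)
  case 0
  have "{ks. set ks \<subseteq> {..<m} \<and> length ks = 0} = {[]}" by auto
  then show ?case using 0 by (simp add: mprod_def mone_def mid_def scal_0 scal_1)
next
  case (Suc L)
  let ?W = "\<lambda>L. {ks. set ks \<subseteq> {..<m} \<and> length ks = L}"
  let ?t = "\<lambda>ks. prod_list (map theta (map (gen p) ks))"
  have "(\<Sum>ks\<in>?W (Suc L). scal (mprod N (map X ks) i j) * ?t ks)
      = (\<Sum>(ks, k)\<in>?W L \<times> {..<m}. scal (mprod N (map X (k # ks)) i j) * ?t (k # ks))"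
    unfolding lists_length_Suc_eq
    by (subst sum.reindex) (auto simp: inj_on_def intro!: sum.cong)
  also have "\<dots> = (\<Sum>ks\<in>?W L. \<Sum>k<m. scal (\<Sum>l<N. X k i l * mprod N (map X ks) l j) * (theta (gen p k) * ?t ks))"
    by (simp add: sum.cartesian_product mprod_def mmul_def)
  also have "\<dots> = (\<Sum>ks\<in>?W L. \<Sum>k<m. \<Sum>l<N. scal (X k i l) * theta (gen p k) * (scal (mprod N (map X ks) l j) * ?t ks))"
  proof (intro sum.cong refl)
    fix ks k
    have "scal x * scal y * (theta a * T) = scal x * theta a * (scal y * T)" for x y a T
      by (metis mult.assoc scal_commute)
    then show "scal (\<Sum>l<N. X k i l * mprod N (map X ks) l j) * (theta (gen p k) * ?t ks)
        = (\<Sum>l<N. scal (X k i l) * theta (gen p k) * (scal (mprod N (map X ks) l j) * ?t ks))"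
      by (simp only: scal_sum scal_mult sum_distrib_right)
  qed
  also have "\<dots> = (\<Sum>ks\<in>?W L. \<Sum>l<N. \<Sum>k<m. scal (X k i l) * theta (gen p k) * (scal (mprod N (map X ks) l j) * ?t ks))"
    by (intro sum.cong refl sum.swap)
  also have "\<dots> = (\<Sum>l<N. \<Sum>ks\<in>?W L. \<Sum>k<m. scal (X k i l) * theta (gen p k) * (scal (mprod N (map X ks) l j) * ?t ks))"
    by (rule sum.swap)
  also have "\<dots> = (\<Sum>l<N. (\<Sum>k<m. scal (X k i l) * theta (gen p k)) * (\<Sum>ks\<in>?W L. scal (mprod N (map X ks) l j) * ?t ks))"
    by (simp only: sum_distrib_left sum_distrib_right)
  also have "\<dots> = (\<Sum>l<N. generic m X p i l * mpow N (generic m X p) L l j)"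
    using Suc.IH by (simp add: generic_def)
  finally show ?case by (simp add: mm_def)
qed

text \<open>A word of length \<open>m\<close> contributes to the coefficient of the product of all
  \<open>m\<close> generators only if each occurs once; such words are permutations, and their
  sorting sign is the sign in \<open>superA\<close>.\<close>

lemma superA_eq_vac_coeff:
  assumes i: "i < N"
  shows "superA N m X p i j = vac_coeff (mpow N (generic m X p) m i j) (gen p ` {..<m})"
proof -
  let ?W = "{ks. set ks \<subseteq> {..<m} \<and> length ks = m}"
  let ?f = "\<lambda>ks. mprod N (map X ks) i j * word_sign (map (gen p) ks)"
  have P: "?W \<inter> {ks. distinct ks \<and> set ks = {..<m}} = (\<lambda>\<sigma>. map \<sigma> [0..<m]) ` {\<sigma>. \<sigma> permutes {0..<m}}" (is "?D = ?P")
  proof (intro equalityI subsetI)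
    fix ks assume "ks \<in> ?D"
    then have ks: "length ks = m" "distinct ks" "set ks = {0..<m}" by (auto simp: atLeast0LessThan)
    \<comment> \<open>Continued by the identity beyond \<open>m\<close>, as \<open>permutes\<close>
      demands.\<close>
    define \<sigma> where "\<sigma> i = (if i < m then ks ! i else i)" for i
    have "bij_betw ((!) ks) {0..<m} {0..<m}"
      using bij_betw_nth[OF ks(2), of "{..<m}" "{0..<m}"] ks by (simp add: atLeast0LessThan)
    then have "bij_betw \<sigma> {0..<m} {0..<m}"
      by (rule bij_betw_cong[THEN iffD1, rotated]) (simp add: \<sigma>_def)
    then have "\<sigma> permutes {0..<m}"
      by (rule bij_imp_permutes) (simp add: \<sigma>_def)
    moreover have "ks = map \<sigma> [0..<m]" using ks(1) by (intro nth_equalityI) (auto simp: \<sigma>_def)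
    ultimately show "ks \<in> ?P" by blast
  next
    fix ks assume "ks \<in> ?P"
    then obtain \<sigma> where \<sigma>: "\<sigma> permutes {0..<m}" "ks = map \<sigma> [0..<m]" by blast
    have "\<sigma> ` {0..<m} = {..<m}" using permutes_image[OF \<sigma>(1)] by (simp add: atLeast0LessThan)
    then show "ks \<in> ?D" using \<sigma>(2) permutes_inj[OF \<sigma>(1)]
      by (auto simp: distinct_map intro: inj_on_subset)
  qed
  have inj: "inj_on (\<lambda>\<sigma>. map \<sigma> [0..<m]) {\<sigma>. \<sigma> permutes {0..<m}}"
  proof (rule inj_onI, rule ext)
    fix \<sigma> \<tau> x
    assume *: "\<sigma> \<in> {\<sigma>. \<sigma> permutes {0..<m}}" "\<tau> \<in> {\<sigma>. \<sigma> permutes {0..<m}}"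
      "map \<sigma> [0..<m] = map \<tau> [0..<m]"
    show "\<sigma> x = \<tau> x"
    proof (cases "x < m")
      case True
      then show ?thesis using *(3) by simp
    next
      case False
      then show ?thesis using *(1,2) by (simp add: permutes_not_in)
    qed
  qed
  have fin: "finite ?W" using finite_lists_length_eq[of "{..<m}" m] by simp
  have "vac_coeff (mpow N (generic m X p) m i j) (gen p ` {..<m})
      = (\<Sum>ks\<in>?W. if distinct ks \<and> set ks = {..<m} then ?f ks else 0)"
    unfolding mpow_generic[OF i] vac_coeff_sum
  proof (intro sum.cong refl)
    fix ks
    have "distinct (map (gen p) ks) \<longleftrightarrow> distinct ks"
      using inj_gen by (auto simp: distinct_map intro: inj_on_subset)
    moreover have "set (map (gen p) ks) = gen p ` {..<m} \<longleftrightarrow> set ks = {..<m}"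
      using inj_image_eq_iff[OF inj_gen] by simp
    ultimately show "vac_coeff (scal (mprod N (map X ks) i j) * prod_list (map theta (map (gen p) ks))) (gen p ` {..<m})
        = (if distinct ks \<and> set ks = {..<m} then ?f ks else 0)"
      unfolding vac_coeff_scal vac_coeff_word by simp
  qed
  also have "\<dots> = sum ?f {ks \<in> ?W. distinct ks \<and> set ks = {..<m}}"
    by (rule sum.inter_filter[OF fin, symmetric])
  also have "{ks \<in> ?W. distinct ks \<and> set ks = {..<m}} = ?D" by auto
  also have "sum ?f ?D = (\<Sum>\<sigma> | \<sigma> permutes {0..<m}. ?f (map \<sigma> [0..<m]))"
    unfolding P by (rule sum.reindex[OF inj, unfolded comp_def])
  also have "\<dots> = superA N m X p i j"
    unfolding superA_def
  proof (intro sum.cong refl)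
    fix \<sigma> assume "\<sigma> \<in> {\<sigma>. \<sigma> permutes {0..<m}}"
    then have "word_sign (map (gen p) (map \<sigma> [0..<m])) = of_int (sign \<sigma>) * (-1) ^ Kinv m \<sigma> p"
      by (intro word_sign_permutation) simp
    then show "?f (map \<sigma> [0..<m]) = of_int (sign \<sigma>) * (-1) ^ Kinv m \<sigma> p * mprod N (map (\<lambda>k. X (\<sigma> k)) [0..<m]) i j"
      by (simp only: map_map comp_def mult.commute)
  qed
  finally show ?thesis by simp
qed

section \<open>The square of the generic orthosymplectic matrix\<close>

text \<open>\<open>blk N M K k\<close> is the sum of all words of weight \<open>k\<close> in
  \<open>M\<close> of weight 1 and \<open>K\<close> of weight 2, so a letter can be split off at
  either end.\<close>

lemma blk_right:
  "i < N \<Longrightarrow> j < N \<Longrightarrow> blk N M K (Suc (Suc k)) i j =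
    mm N (blk N M K (Suc k)) M i j + mm N (blk N M K k) K i j"
proof (induction k arbitrary: i j rule: induct_nat_012)
  case 0
  have "mm N M (mm N M mid) i j = mm N (mm N M mid) M i j"
    unfolding mm_assoc by (rule mm_cong[OF refl]) (use 0 in \<open>simp_all add: mm_mid_left mm_mid_right\<close>)
  then show ?case using 0 by (simp add: blk_Suc_Suc mm_mid_left mm_mid_right)
next
  case 1
  have 0: "mm N M (mm N K mid) i j = mm N (mm N M mid) K i j"
    unfolding mm_assoc by (rule mm_cong[OF refl]) (use 1 in \<open>simp_all add: mm_mid_left mm_mid_right\<close>)
  have 2: "mm N K (mm N M mid) i j = mm N (mm N K mid) M i j"
    unfolding mm_assoc by (rule mm_cong[OF refl]) (use 1 in \<open>simp_all add: mm_mid_left mm_mid_right\<close>)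
  have 3: "mm N M (mm N M (mm N M mid)) i j = mm N (mm N M (mm N M mid)) M i j"
    unfolding mm_assoc by (rule mm_cong[OF refl], rule mm_cong[OF refl]) (use 1 in \<open>simp_all add: mm_mid_left mm_mid_right\<close>)
  show ?case
    unfolding blk_Suc_Suc blk.simps(1,2) mm_add_left mm_add_right
    unfolding plus_fun_apply 0 2 3 by (simp only: ac_simps)
next
  case (ge2 k)
  have "mm N M (blk N M K (Suc (Suc (Suc k)))) i j =
      mm N M (mm N (blk N M K (Suc (Suc k))) M + mm N (blk N M K (Suc k)) K) i j"
    by (rule mm_cong[OF refl]) (use ge2 in auto)
  moreover have "mm N K (blk N M K (Suc (Suc k))) i j =
      mm N K (mm N (blk N M K (Suc k)) M + mm N (blk N M K k) K) i j"
    by (rule mm_cong[OF refl]) (use ge2 in auto)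
  ultimately show ?case
    unfolding blk_Suc_Suc[of N M K "Suc (Suc k)"] mm_add_right
    unfolding plus_fun_apply mm_assoc[symmetric]
    unfolding blk_Suc_Suc[of N M K "Suc k"] blk_Suc_Suc[of N M K k] mm_add_left
    unfolding plus_fun_apply by (simp only: ac_simps)
qed

text \<open>With respect to the skew form \<open>G\<close>, \<open>M\<close> is skew-adjoint and
  \<open>K\<close> self-adjoint. The adjoint reverses words and gives a word of weight
  \<open>k\<close> the sign \<open>(-1)^k\<close>; the sum of all such words is stable under
  reversal.\<close>

lemma blk_symmetric:
  fixes M K G :: "nat \<Rightarrow> nat \<Rightarrow> 'a::comm_ring_1"
  assumes G: "\<And>i j. i < N \<Longrightarrow> j < N \<Longrightarrow> G i j = - G j i"
    and GM: "\<And>i j. i < N \<Longrightarrow> j < N \<Longrightarrow> mm N G M i j = mm N G M j i"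
    and GK: "\<And>i j. i < N \<Longrightarrow> j < N \<Longrightarrow> mm N G K i j = - mm N G K j i"
  shows "i < N \<Longrightarrow> j < N \<Longrightarrow> mm N G (blk N M K k) i j = (-1) ^ Suc k * mm N G (blk N M K k) j i"
proof (induction k arbitrary: i j rule: induct_nat_012)
  case 0
  then show ?case using G[OF 0] by (simp add: mm_mid_right)
next
  case 1
  then show ?case using GM[OF 1] by (simp add: mm_assoc[symmetric] mm_mid_right)
next
  case (ge2 k)
  \<comment> \<open>\<open>c\<close> and \<open>- e\<close> are the symmetry signs of
    \<open>G Y\<close> and \<open>G Z\<close>; reversing the product uses the skewness of
    \<open>G\<close> once more.\<close>
  have swap: "mm N (mm N G Y) Z i j = e * c * mm N G (mm N Z Y) j i"
    if Y: "\<And>i j. i < N \<Longrightarrow> j < N \<Longrightarrow> mm N G Y i j = c * mm N G Y j i"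
      and Z: "\<And>i j. i < N \<Longrightarrow> j < N \<Longrightarrow> mm N G Z i j = - e * mm N G Z j i"
      and "e * e = 1" for Y Z c e
  proof -
    have ee: "e * (e * x) = x" for x using that(3) by (simp add: mult.assoc[symmetric])
    have "mm N (mm N G Y) Z i j = (\<Sum>l<N. c * (\<Sum>r<N. G l r * Y r i) * Z l j)"
      unfolding mm_def[of _ "mm N G Y"]
    proof (intro sum.cong refl)
      fix l assume "l \<in> {..<N}"
      then have "mm N G Y i l = c * mm N G Y l i" using Y ge2.prems by blast
      then show "mm N G Y i l * Z l j = c * (\<Sum>r<N. G l r * Y r i) * Z l j"
        by (simp only: mm_def)
    qed
    also have "\<dots> = (\<Sum>r<N. \<Sum>l<N. c * (G l r * Y r i * Z l j))"
      by (subst sum.swap) (simp add: sum_distrib_left sum_distrib_right mult.assoc)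
    also have "\<dots> = (\<Sum>r<N. - c * (mm N G Z r j * Y r i))"
    proof (intro sum.cong refl)
      fix r assume "r \<in> {..<N}"
      have "(\<Sum>l<N. c * (G l r * Y r i * Z l j)) = (\<Sum>l<N. - c * (G r l * Z l j * Y r i))"
      proof (intro sum.cong refl)
        fix l assume "l \<in> {..<N}"
        then have "G l r = - G r l" using G \<open>r \<in> {..<N}\<close> by blast
        then show "c * (G l r * Y r i * Z l j) = - c * (G r l * Z l j * Y r i)"
          by (simp add: algebra_simps)
      qed
      then show "(\<Sum>l<N. c * (G l r * Y r i * Z l j)) = - c * (mm N G Z r j * Y r i)"
        by (simp only: mm_def sum_distrib_left sum_distrib_right)
    qed
    also have "\<dots> = (\<Sum>r<N. e * c * (mm N G Z j r * Y r i))"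
    proof (intro sum.cong refl)
      fix r assume "r \<in> {..<N}"
      then have "mm N G Z r j = - e * mm N G Z j r" using Z ge2.prems by blast
      then show "- c * (mm N G Z r j * Y r i) = e * c * (mm N G Z j r * Y r i)"
        by (simp add: algebra_simps)
    qed
    also have "\<dots> = e * c * mm N (mm N G Z) Y j i"
      by (simp only: mm_def[of _ "mm N G Z"] sum_distrib_left)
    finally show ?thesis by (simp only: mm_assoc)
  qed
  have GM': "mm N G M i j = - (- 1) * mm N G M j i" if "i < N" "j < N" for i j
    using GM[OF that] by (simp only: minus_minus mult_1_left)
  have GK': "mm N G K i j = - 1 * mm N G K j i" if "i < N" "j < N" for i j
    using GK[OF that] by (simp only: mult_minus_left mult_1_left)
  have 1: "mm N (mm N G (blk N M K (Suc k))) M i j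
      = (-1) * (-1) ^ Suc (Suc k) * mm N G (mm N M (blk N M K (Suc k))) j i"
    by (rule swap) (erule (1) ge2.IH(2), erule (1) GM', simp)
  have 2: "mm N (mm N G (blk N M K k)) K i j
      = 1 * (-1) ^ Suc k * mm N G (mm N K (blk N M K k)) j i"
    by (rule swap) (erule (1) ge2.IH(1), erule (1) GK', simp)
  have "mm N G (blk N M K (Suc (Suc k))) i j
      = mm N G (mm N (blk N M K (Suc k)) M + mm N (blk N M K k) K) i j"
    by (rule mm_cong[OF refl]) (use ge2.prems in \<open>simp add: blk_right\<close>)
  also have "\<dots> = mm N (mm N G (blk N M K (Suc k))) M i j + mm N (mm N G (blk N M K k)) K i j"
    unfolding mm_add_right mm_assoc by simp
  also have "\<dots> = (-1) ^ Suc (Suc (Suc k)) * mm N G (blk N M K (Suc (Suc k))) j i"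
    unfolding 1 2 blk_Suc_Suc[of N M K k] mm_add_right
    unfolding plus_fun_apply by (simp add: algebra_simps)
  finally show ?case .
qed

lemma oper_eq_minus_self:
  assumes "x = - (x :: oper)"
  shows "x = 0"
proof -
  have "scal (1/2) * (x + x) = x"
    unfolding distrib_left distrib_right[symmetric] scal_add[symmetric] by (simp add: scal_1)
  then show ?thesis using assms by (metis add.right_inverse mult_zero_right)
qed

lemma oper_of_nat_mult_eq_0:
  assumes "of_nat k * (x :: oper) = 0" "k > 0"
  shows "x = 0"
proof -
  have "x = scal (1 / of_nat k) * (of_nat k * x)"
    unfolding scal_of_nat[symmetric] mult.assoc[symmetric] scal_mult[symmetric] using assms(2) by (simp add: scal_1)
  then show ?thesis using assms(1) by simp
qed

lemma Ev_inverse': "x \<in> alg \<Longrightarrow> swp 0 0 x \<Longrightarrow> opr (Ev x) = x"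
  by (rule Ev_inverse) simp

lemma opr_inject': "opr x = opr y \<Longrightarrow> x = y"
  by (simp add: opr_inject)

text \<open>Index 0 is the even line, \<open>Suc i\<close> the odd part. Diagonal blocks carry
  generators of even index, off-diagonal ones those of odd index, which fixes the signs;
  \<open>G\<close> is the skew form scaled so that \<open>Th_row\<close> has no extra
  factor.\<close>

locale osp_generic =
  fixes N :: nat and Th :: "nat \<Rightarrow> nat \<Rightarrow> oper" and G g :: "nat \<Rightarrow> nat \<Rightarrow> complex"
  assumes Th_0_0: "Th 0 0 = 0"
    and Th_alg: "Th i j \<in> alg"
    and Th_diag: "(i = 0) = (j = 0) \<Longrightarrow> swp m q T \<Longrightarrow> Th i j * T = (-1) ^ m * (T * Th i j)"
    and Th_off: "(i = 0) \<noteq> (j = 0) \<Longrightarrow> swp m q T \<Longrightarrow> Th i j * T = (-1) ^ q * (T * Th i j)"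
    and swp_diag: "(i = 0) = (j = 0) \<Longrightarrow> swp 1 1 (Th i j)"
    and swp_off: "(i = 0) \<noteq> (j = 0) \<Longrightarrow> swp 1 0 (Th i j)"
    and G_skew: "i < N \<Longrightarrow> j < N \<Longrightarrow> G i j = - G j i"
    and Gg: "i < N \<Longrightarrow> j < N \<Longrightarrow> mm N G g i j = mid i j"
    and gG: "i < N \<Longrightarrow> j < N \<Longrightarrow> mm N g G i j = mid i j"
    and Th_row: "j < N \<Longrightarrow> Th 0 (Suc j) = (\<Sum>i<N. scal (G i j) * Th (Suc i) 0)"
    and GS_sym: "i < N \<Longrightarrow> j < N \<Longrightarrow>
      (\<Sum>k<N. scal (G i k) * Th (Suc k) (Suc j)) = (\<Sum>k<N. scal (G j k) * Th (Suc k) (Suc i))"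
begin

text \<open>The blocks of \<open>\<Theta> = ((0, u), (v, S))\<close> and of its square
  \<open>((0, a), (b, M))\<close>; the corner \<open>u v\<close> of the square vanishes by
  \<open>uv_0\<close>.\<close>

definition "u j = Th 0 (Suc j)"
definition "v i = Th (Suc i) 0"
definition "S i j = Th (Suc i) (Suc j)"
definition "a j = (\<Sum>i<N. u i * S i j)"
definition "b i = (\<Sum>k<N. S i k * v k)"
definition "M i j = v i * u j + (\<Sum>k<N. S i k * S k j)"
definition "K i j = b i * a j"

section \<open>Commutation rules and symmetries of the blocks\<close>

lemma S_move: "swp m q T \<Longrightarrow> S i j * T = (-1) ^ m * (T * S i j)"
  unfolding S_def by (rule Th_diag) auto

lemma u_move: "swp m q T \<Longrightarrow> u j * T = (-1) ^ q * (T * u j)"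
  unfolding u_def by (rule Th_off) auto

lemma v_move: "swp m q T \<Longrightarrow> v j * T = (-1) ^ q * (T * v j)"
  unfolding v_def by (rule Th_off) auto

lemma swp_S: "swp 1 1 (S i j)" and swp_u: "swp 1 0 (u j)" and swp_v: "swp 1 0 (v i)"
  unfolding S_def u_def v_def by (auto intro: swp_diag[simplified] swp_off[simplified])

lemma SS: "S i j * S k l = - (S k l * S i j)" and Sv: "S i j * v k = - (v k * S i j)"
  and vv: "v i * v j = v j * v i" and uu: "u i * u j = u j * u i"
  using S_move[OF swp_S, of i j k l] S_move[OF swp_v, of i j k] v_move[OF swp_v, of i j] u_move[OF swp_u, of i j]
  by simp_all

text \<open>Each term of \<open>a j\<close> contains one generator of either parity of index, which
  makes \<open>a\<close>, and likewise \<open>b\<close>, the odd entries of the square.\<close>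

lemma swp_a: "swp 0 1 (a j)"
  unfolding a_def by (rule swp_sum, rule swp_parity[OF swp_mult[OF swp_u swp_S]]) simp_all

lemma swp_b: "swp 0 1 (b i)"
  unfolding b_def by (rule swp_sum, rule swp_parity[OF swp_mult[OF swp_S swp_v]]) simp_all

lemma swp_M: "swp 0 0 (M i j)"
proof -
  have "swp 0 0 (v i * u j)" by (rule swp_parity[OF swp_mult[OF swp_v swp_u]]) simp_all
  moreover have "swp 0 0 (S i k * S k j)" for k
    by (rule swp_parity[OF swp_mult[OF swp_S swp_S]]) simp_all
  ultimately show ?thesis unfolding M_def by (intro swp_add swp_sum)
qed

lemma swp_K: "swp 0 0 (K i j)"
  unfolding K_def by (rule swp_parity[OF swp_mult[OF swp_b swp_a]]) simp_all

lemma alg_entries: "u j \<in> alg" "v j \<in> alg" "S i j \<in> alg" "a j \<in> alg" "b i \<in> alg" "M i j \<in> alg" "K i j \<in> alg"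
  by (auto simp: u_def v_def S_def a_def b_def M_def K_def intro!: alg_add alg_sum alg_mult Th_alg)

lemma a_move: assumes T: "swp 0 q T" shows "a j * T = (-1) ^ q * (T * a j)"
proof -
  have "u i * S i j * T = (-1) ^ q * (T * (u i * S i j))" for i
    using S_move[OF T, of i j] u_move[OF T, of i] by (simp add: mult.assoc) (metis mult.assoc)
  then show ?thesis by (simp add: a_def sum_distrib_left sum_distrib_right)
qed

lemma b_move: assumes T: "swp 0 q T" shows "b j * T = (-1) ^ q * (T * b j)"
proof -
  have "S j k * v k * T = (-1) ^ q * (T * (S j k * v k))" for k
  proof -
    have "S j k * (v k * T) = (-1) ^ q * (S j k * T * v k)"
      unfolding v_move[OF T] by (simp add: minus_one_power_commute mult.assoc[symmetric])
    then show ?thesis using S_move[OF T, of j k] by (simp add: mult.assoc)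
  qed
  then show ?thesis by (simp add: b_def sum_distrib_left sum_distrib_right)
qed

lemma odd_anticommute: "a i * a j = - (a j * a i)" "a i * b j = - (b j * a i)" "b i * b j = - (b j * b i)"
  using a_move[OF swp_a, of i j] a_move[OF swp_b, of i j] b_move[OF swp_b, of i j] by simp_all

text \<open>\<open>u\<close> is dual to \<open>v\<close> under the skew form, and the entries of
  \<open>v\<close> commute, so the sum is its own negative.\<close>

lemma uv_0: "(\<Sum>k<N. u k * v k) = 0"
proof (rule oper_eq_minus_self)
  have "(\<Sum>k<N. u k * v k) = (\<Sum>k<N. \<Sum>i<N. scal (G i k) * (v i * v k))"
    by (intro sum.cong refl) (simp add: u_def v_def Th_row sum_distrib_right mult.assoc)
  also have "\<dots> = (\<Sum>k<N. \<Sum>i<N. - (scal (G k i) * (v k * v i)))"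
  proof (intro sum.cong refl)
    fix k i assume "k \<in> {..<N}" "i \<in> {..<N}"
    then have "G i k = - G k i" by (intro G_skew) auto
    then show "scal (G i k) * (v i * v k) = - (scal (G k i) * (v k * v i))"
      using vv[of i k] by (simp add: scal_minus)
  qed
  also have "\<dots> = - (\<Sum>k<N. \<Sum>i<N. scal (G i k) * (v i * v k))"
    by (subst sum.swap) (simp add: sum_negf)
  also have "(\<Sum>k<N. \<Sum>i<N. scal (G i k) * (v i * v k)) = (\<Sum>k<N. u k * v k)"
    by (intro sum.cong refl) (simp add: u_def v_def Th_row sum_distrib_right mult.assoc)
  finally show "(\<Sum>k<N. u k * v k) = - (\<Sum>k<N. u k * v k)" .
qed

lemma u_alt:
  assumes "j < N" shows "u j = - (\<Sum>k<N. scal (G j k) * v k)"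
proof -
  have "u j = (\<Sum>k<N. - (scal (G j k) * v k))"
    unfolding u_def Th_row[OF assms] v_def
  proof (intro sum.cong refl)
    fix k assume "k \<in> {..<N}"
    then have "G k j = - G j k" using assms by (intro G_skew) auto
    then show "scal (G k j) * Th (Suc k) 0 = - (scal (G j k) * Th (Suc k) 0)"
      by (simp add: scal_minus)
  qed
  then show ?thesis by (simp add: sum_negf)
qed

lemma GS: "i < N \<Longrightarrow> j < N \<Longrightarrow>
    (\<Sum>k<N. scal (G i k) * S k j) = (\<Sum>k<N. scal (G j k) * S k i)"
  unfolding S_def by (rule GS_sym)

text \<open>The duality of \<open>u\<close> and \<open>v\<close> passes to \<open>u S\<close> and
  \<open>S v\<close>, since \<open>G S\<close> is symmetric and \<open>S\<close> anticommutes with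
  \<open>v\<close>.\<close>

lemma a_alt:
  assumes j: "j < N" shows "a j = - (\<Sum>k<N. scal (G j k) * b k)"
proof -
  have "a j = (\<Sum>i<N. \<Sum>l<N. scal (G i l) * (S i j * v l))"
    unfolding a_def
    by (intro sum.cong refl) (simp add: u_alt sum_distrib_right mult.assoc Sv sum_negf)
  also have "\<dots> = (\<Sum>l<N. \<Sum>i<N. - (scal (G l i) * S i j * v l))"
  proof (subst sum.swap, intro sum.cong refl)
    fix i l assume "i \<in> {..<N}" "l \<in> {..<N}"
    then have "G i l = - G l i" by (intro G_skew) auto
    then show "scal (G i l) * (S i j * v l) = - (scal (G l i) * S i j * v l)"
      by (simp add: scal_minus mult.assoc)
  qed
  also have "\<dots> = (\<Sum>l<N. - ((\<Sum>i<N. scal (G l i) * S i j) * v l))"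
    by (simp only: sum_distrib_right sum_negf)
  also have "\<dots> = (\<Sum>l<N. - ((\<Sum>i<N. scal (G j i) * S i l) * v l))"
    using j by (intro sum.cong refl) (simp add: GS)
  also have "\<dots> = - (\<Sum>l<N. \<Sum>i<N. scal (G j i) * (S i l * v l))"
    by (simp only: sum_distrib_right sum_negf mult.assoc)
  also have "\<dots> = - (\<Sum>k<N. scal (G j k) * b k)"
    by (subst sum.swap) (simp only: b_def sum_distrib_left)
  finally show ?thesis .
qed

text \<open>\<open>G v u\<close> is \<open>- u u\<close> with commuting entries of \<open>u\<close>.
  For \<open>G S S\<close>, the sign from the skewness of \<open>G\<close> cancels the one from the
  anticommuting entries of \<open>S\<close>.\<close>

lemma GM_sym:
  assumes i: "i < N" and j: "j < N"
  shows "(\<Sum>k<N. scal (G i k) * M k j) = (\<Sum>k<N. scal (G j k) * M k i)"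
proof -
  have split: "(\<Sum>k<N. scal (G i k) * M k j) = - (u i * u j) + (\<Sum>l<N. (\<Sum>k<N. scal (G i k) * S k l) * S l j)"
    if "i < N" for i j
  proof -
    have "(\<Sum>k<N. scal (G i k) * M k j) = (\<Sum>k<N. scal (G i k) * v k) * u j
        + (\<Sum>k<N. \<Sum>l<N. scal (G i k) * S k l * S l j)"
      by (simp add: M_def distrib_left sum.distrib sum_distrib_left sum_distrib_right mult.assoc)
    also have "(\<Sum>k<N. \<Sum>l<N. scal (G i k) * S k l * S l j) = (\<Sum>l<N. (\<Sum>k<N. scal (G i k) * S k l) * S l j)"
      by (subst sum.swap) (simp only: sum_distrib_right)
    finally show ?thesis using u_alt[OF that] by simp
  qed
  have "(\<Sum>l<N. (\<Sum>k<N. scal (G i k) * S k l) * S l j) = (\<Sum>l<N. (\<Sum>k<N. scal (G l k) * S k i) * S l j)"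
    using i by (intro sum.cong refl) (simp add: GS)
  also have "\<dots> = (\<Sum>k<N. \<Sum>l<N. scal (G l k) * (S k i * S l j))"
    by (subst sum.swap) (simp only: sum_distrib_right mult.assoc)
  also have "\<dots> = (\<Sum>k<N. \<Sum>l<N. scal (G k l) * S l j * S k i)"
  proof (intro sum.cong refl)
    fix k l assume "k \<in> {..<N}" "l \<in> {..<N}"
    then have "G l k = - G k l" by (intro G_skew) auto
    then show "scal (G l k) * (S k i * S l j) = scal (G k l) * S l j * S k i"
      by (simp add: scal_minus mult.assoc SS[of k i])
  qed
  also have "\<dots> = (\<Sum>k<N. (\<Sum>l<N. scal (G k l) * S l j) * S k i)"
    by (simp only: sum_distrib_right)
  also have "\<dots> = (\<Sum>k<N. (\<Sum>l<N. scal (G j l) * S l k) * S k i)"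
    using j by (intro sum.cong refl) (simp add: GS)
  finally show ?thesis unfolding split[OF i] split[OF j] by (simp add: uu[of i j])
qed

text \<open>By duality \<open>G K\<close> is \<open>- a a\<close>, and the entries of
  \<open>a\<close> anticommute.\<close>

lemma GK_skew:
  assumes i: "i < N" and j: "j < N"
  shows "(\<Sum>k<N. scal (G i k) * K k j) = - (\<Sum>k<N. scal (G j k) * K k i)"
proof -
  have "(\<Sum>k<N. scal (G i k) * K k j) = - (a i * a j)" if "i < N" for i j
    using a_alt[OF that] by (simp add: K_def sum_distrib_right mult.assoc)
  then show ?thesis using i j odd_anticommute(1)[of i j] by simp
qed

text \<open>Exchanging two odd entries across a third takes three anticommutations. The free factor
  \<open>x\<close> covers both exchange hypotheses of \<open>blk_identity\<close>.\<close>

lemma odd_swap: "x * a j * K k l = - (x * a l * K k j)"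
proof -
  have "a j * (b k * a l) = - (b k * a j * a l)"
    by (simp only: mult.assoc[symmetric] odd_anticommute(2)) simp
  also have "\<dots> = b k * (a l * a j)" by (simp only: mult.assoc odd_anticommute(1)[of j l]) simp
  also have "\<dots> = - (a l * (b k * a j))"
    by (simp only: mult.assoc[symmetric] odd_anticommute(2)) simp
  finally show ?thesis by (simp add: K_def mult.assoc)
qed

abbreviation "Y \<equiv> blk N M K"

section \<open>Powers of the square and their supertraces\<close>

lemma Th_sq:
  "mm (Suc N) Th Th 0 0 = 0"
  "mm (Suc N) Th Th 0 (Suc j) = a j"
  "mm (Suc N) Th Th (Suc i) 0 = b i"
  "mm (Suc N) Th Th (Suc i) (Suc j) = M i j"
  using uv_0 by (simp_all add: mm_def sum.lessThan_Suc_shift Th_0_0 u_def v_def S_def a_def b_def M_def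
      del: sum.lessThan_Suc)

lemma mpow_Th_Suc:
  "mpow (Suc N) Th (2 * Suc k) = mm (Suc N) (mm (Suc N) Th Th) (mpow (Suc N) Th (2 * k))"
  by (simp add: mm_assoc)

lemma mpow_Th_blocks:
  assumes "j < N"
  shows "mpow (Suc N) Th (2 * Suc k) (Suc i) (Suc j) = Y (Suc k) i j"
    and "mpow (Suc N) Th (2 * Suc k) 0 (Suc j) = (\<Sum>l<N. a l * Y k l j)"
proof -
  have "(\<forall>i. mpow (Suc N) Th (2 * Suc k) (Suc i) (Suc j) = Y (Suc k) i j) \<and>
    mpow (Suc N) Th (2 * Suc k) 0 (Suc j) = (\<Sum>l<N. a l * Y k l j)"
  proof (induction k)
    case 0
    show ?case
      unfolding mpow_Th_Suc[of 0] mm_def[of _ "mm (Suc N) Th Th"] sum.lessThan_Suc_shift Th_sq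
      by (simp add: mm_def[of _ M] mid_def)
  next
    case (Suc k)
    have KY: "mm N K (Y k) i j = b i * (\<Sum>l<N. a l * Y k l j)" for i
      by (simp add: mm_def K_def sum_distrib_left mult.assoc)
    have "mpow (Suc N) Th (2 * Suc (Suc k)) (Suc i) (Suc j) = Y (Suc (Suc k)) i j" for i
      unfolding mpow_Th_Suc[of "Suc k"] mm_def[of _ "mm (Suc N) Th Th"] sum.lessThan_Suc_shift Th_sq blk_Suc_Suc
      unfolding plus_fun_apply KY mm_def[of _ M] using Suc by (simp add: add.commute)
    moreover have "mpow (Suc N) Th (2 * Suc (Suc k)) 0 (Suc j) = (\<Sum>l<N. a l * Y (Suc k) l j)"
      unfolding mpow_Th_Suc[of "Suc k"] mm_def[of _ "mm (Suc N) Th Th"] sum.lessThan_Suc_shift Th_sq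
      using Suc by simp
    ultimately show ?case by blast
  qed
  then show "mpow (Suc N) Th (2 * Suc k) (Suc i) (Suc j) = Y (Suc k) i j"
    and "mpow (Suc N) Th (2 * Suc k) 0 (Suc j) = (\<Sum>l<N. a l * Y k l j)" by blast+
qed

lemma mpow_Th_column:
  "(\<forall>i<N. mpow (Suc N) Th (2 * Suc k) (Suc i) 0 = (\<Sum>l<N. Y k i l * b l)) \<and>
    mpow (Suc N) Th (2 * Suc k) 0 0 = (if k = 0 then 0 else \<Sum>l<N. \<Sum>r<N. a l * (Y (k - 1) l r * b r))"
proof (induction k)
  case 0
  have "(\<Sum>l<N. mid i l * b l) = b i" if "i < N" for i
    using mm_mid_left[OF that, of "\<lambda>l _. b l"] by (simp add: mm_def)
  then show ?case
    unfolding mpow_Th_Suc[of 0] mm_def[of _ "mm (Suc N) Th Th"] sum.lessThan_Suc_shift Th_sq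
    by (simp add: mid_def)
next
  case (Suc k)
  have MY: "(\<Sum>l<N. M i l * (\<Sum>r<N. Y k l r * b r)) = (\<Sum>r<N. mm N M (Y k) i r * b r)" for i
    using fun_cong[OF fun_cong[OF mm_assoc[of N N M "Y k" "\<lambda>r _. b r"], of i], of 0] by (simp add: mm_def)
  have KY: "b i * (\<Sum>l<N. \<Sum>r<N. a l * (Y k' l r * b r)) = (\<Sum>r<N. mm N K (Y k') i r * b r)" for i k'
    unfolding mm_def sum_distrib_left sum_distrib_right
    by (subst sum.swap) (simp add: K_def mult.assoc)
  have "mpow (Suc N) Th (2 * Suc (Suc k)) (Suc i) 0 = (\<Sum>l<N. Y (Suc k) i l * b l)" if "i < N" for i
  proof -
    have "mpow (Suc N) Th (2 * Suc (Suc k)) (Suc i) 0 =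
        b i * mpow (Suc N) Th (2 * Suc k) 0 0 + (\<Sum>r<N. mm N M (Y k) i r * b r)"
      unfolding mpow_Th_Suc[of "Suc k"] mm_def[of _ "mm (Suc N) Th Th"] sum.lessThan_Suc_shift Th_sq
      using Suc MY by simp
    also have "\<dots> = (\<Sum>l<N. Y (Suc k) i l * b l)"
    \<comment> \<open>The corner of the first power of the square is zero; for later powers it
      supplies the term with \<open>K\<close> in the recursion of \<open>blk\<close>.\<close>
    proof (cases k)
      case 0
      then show ?thesis using Suc by simp
    next
      case (Suc k')
      have "b i * mpow (Suc N) Th (2 * Suc k) 0 0 = (\<Sum>r<N. mm N K (Y k') i r * b r)"
        using Suc.IH Suc KY[of i k'] by simp
      then show ?thesis unfolding Suc blk_Suc_Suc
        by (simp add: distrib_right sum.distrib add.commute)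
    qed
    finally show ?thesis .
  qed
  moreover have "mpow (Suc N) Th (2 * Suc (Suc k)) 0 0 = (\<Sum>l<N. \<Sum>r<N. a l * (Y k l r * b r))"
    unfolding mpow_Th_Suc[of "Suc k"] mm_def[of _ "mm (Suc N) Th Th"] sum.lessThan_Suc_shift Th_sq
    using Suc by (simp add: sum_distrib_left)
  ultimately show ?case by simp
qed

text \<open>Factors that cross between the blocks carry generators of odd index, and a path from
  \<open>i\<close> to \<open>j\<close> has an even number of crossings exactly when both lie in the
  same block.\<close>

lemma swp_mpow_Th:
  "swp L (if (i = 0) = (j = 0) then L else Suc L) (mpow (Suc N) Th L i j)"
proof (induction L arbitrary: i)
  case 0
  then show ?case by (auto simp: mid_def swp_0 swp_1)
next
  case (Suc L)
  have "swp (Suc L) (if (i = 0) = (j = 0) then Suc L else Suc (Suc L)) (Th i l * mpow (Suc N) Th L l j)" for l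
  proof -
    have "swp 1 (if (i = 0) = (l = 0) then 1 else 0) (Th i l)"
      using swp_diag[of i l] swp_off[of i l] by auto
    from swp_mult[OF this Suc.IH[of l]] show ?thesis
      by (rule swp_parity) auto
  qed
  then show ?case unfolding mpow.simps mm_def by (rule swp_sum)
qed

text \<open>\<open>\<Theta>\<close> is odd, so the supertrace of \<open>\<Theta> \<Psi>\<close> with an odd power \<open>\<Psi>\<close> of \<open>\<Theta>\<close> is minus that of \<open>\<Psi> \<Theta>\<close>.\<close>

lemma supertrace_0:
  "mpow (Suc N) Th (2 * Suc k) 0 0 = (\<Sum>i<N. mpow (Suc N) Th (2 * Suc k) (Suc i) (Suc i))"
proof -
  define L where "L = 2 * k + 1"
  have L: "odd L" "2 * Suc k = Suc L" by (simp_all add: L_def)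
  define e :: "nat \<Rightarrow> oper" where "e i = (if i = 0 then 1 else - 1)" for i
  let ?P = "mpow (Suc N) Th L"
  have e: "e i * (Th i j * ?P j i) = - (e j * (?P j i * Th i j))" for i j
  proof (cases "(i = 0) = (j = 0)")
    case True
    then have "Th i j * ?P j i = - (?P j i * Th i j)"
      using Th_diag[OF _ swp_mpow_Th, of i j] L by simp
    then show ?thesis using True by (simp add: e_def)
  next
    case False
    then have "Th i j * ?P j i = ?P j i * Th i j"
      using Th_off[OF _ swp_mpow_Th, of i j L j i] L by (auto split: if_splits)
    then show ?thesis using False by (auto simp: e_def)
  qed
  have "(\<Sum>i<Suc N. e i * mpow (Suc N) Th (Suc L) i i) = (\<Sum>i<Suc N. \<Sum>j<Suc N. e i * (Th i j * ?P j i))"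
    unfolding mpow.simps mm_def sum_distrib_left ..
  also have "\<dots> = (\<Sum>i<Suc N. \<Sum>j<Suc N. - (e j * (?P j i * Th i j)))"
    by (intro sum.cong refl e)
  also have "\<dots> = - (\<Sum>j<Suc N. e j * mm (Suc N) ?P Th j j)"
    unfolding mm_def sum_distrib_left sum_negf by (subst sum.swap) (rule refl)
  also have "(\<Sum>j<Suc N. e j * mm (Suc N) ?P Th j j) = (\<Sum>i<Suc N. e i * mpow (Suc N) Th (Suc L) i i)"
    by (intro sum.cong refl) (simp add: mpow_Suc2 del: mpow.simps)
  finally have "(\<Sum>i<Suc N. e i * mpow (Suc N) Th (Suc L) i i) = 0"
    by (rule oper_eq_minus_self)
  then show ?thesis
    unfolding L sum.lessThan_Suc_shift by (simp add: e_def sum_negf del: mpow.simps)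
qed

lemma swp_Y: "swp 0 0 (Y k i j)"
proof (induction k arbitrary: i j rule: induct_nat_012)
  case 0
  then show ?case by (simp add: mid_def swp_0 swp_1)
next
  case 1
  have "swp 0 0 (mid i j)" for i j by (simp add: mid_def swp_0 swp_1)
  then show ?case by (auto simp: mm_def intro!: swp_sum swp_0_0_mult swp_M)
next
  case (ge2 k)
  then show ?case unfolding blk_Suc_Suc
    by (auto simp: mm_def intro!: swp_add swp_sum swp_0_0_mult swp_M swp_K)
qed

text \<open>Anticommuting \<open>a\<close> and \<open>b\<close> turns the corner
  \<open>a Y b\<close> into \<open>- tr (K Y)\<close>, so this is the vanishing supertrace read off
  the blocks.\<close>

lemma str_Y:
  "blk_str N M K (Suc k) = 0"
proof (cases k)
  case 0
  have "(\<Sum>i<N. mpow (Suc N) Th (2 * Suc 0) (Suc i) (Suc i)) = tr N (Y (Suc 0))"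
    unfolding tr_def by (intro sum.cong refl mpow_Th_blocks) simp
  then show ?thesis using supertrace_0[of 0] mpow_Th_column[of 0] 0 by (simp add: blk_str_def)
next
  case (Suc k')
  have 1: "(\<Sum>i<N. mpow (Suc N) Th (2 * Suc k) (Suc i) (Suc i)) = tr N (Y (Suc k))"
    unfolding tr_def by (intro sum.cong refl mpow_Th_blocks) simp
  have "a l * (Y k' l r * b r) = - (K r l * Y k' l r)" for l r
  proof -
    have "Y k' l r * b r = b r * Y k' l r" using b_move[OF swp_Y, of r k' l r] by simp
    then show ?thesis
      by (simp add: K_def mult.assoc[symmetric] odd_anticommute(2))
  qed
  then have "mpow (Suc N) Th (2 * Suc k) 0 0 = - tr N (mm N K (Y k'))"
    using mpow_Th_column[of k] Suc
    by (simp add: tr_def mm_def sum_negf) (rule sum.swap)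
  then have "tr N (Y (Suc (Suc k'))) = - tr N (mm N K (Y k'))"
    using supertrace_0[of k] 1 Suc by (simp only:)
  then show ?thesis using Suc by (simp add: blk_str_def)
qed

section \<open>Vanishing of the blocks, through the commutative ring \<open>ev\<close>\<close>

definition "Me i j = Ev (M i j)"
definition "Ke i j = Ev (K i j)"
definition "Ge i j = Ev (scal (G i j))"
definition "ge i j = Ev (scal (g i j))"

lemma opr_entries: "opr (Me i j) = M i j" "opr (Ke i j) = K i j"
    "opr (Ge i j) = scal (G i j)" "opr (ge i j) = scal (g i j)"
  by (simp_all add: Me_def Ke_def Ge_def ge_def Ev_inverse' alg_entries swp_M swp_K alg_scal swp_scal)

lemma opr_Y: "opr (blk N Me Ke k i j) = Y k i j"
  by (simp add: opr_blk opr_entries)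

lemma even_hyps:
  shows "i < N \<Longrightarrow> j < N \<Longrightarrow> mm N Ge ge i j = mid i j"
    and "i < N \<Longrightarrow> j < N \<Longrightarrow> mm N ge Ge i j = mid i j"
    and "i < N \<Longrightarrow> j < N \<Longrightarrow> mm N Ge Me i j = mm N Ge Me j i"
    and "i < N \<Longrightarrow> j < N \<Longrightarrow> mm N Ge Ke i j = - mm N Ge Ke j i"
    and "Ke i j * Ke k l = - (Ke i l * Ke k j)"
    and "i < N \<Longrightarrow> j < N \<Longrightarrow> Ge i j = - Ge j i"
proof -
  have mid: "opr (mid i j) = scal (mid i j)" for i j
    by (simp add: mid_def scal_0 scal_1 zero_ev.rep_eq one_ev.rep_eq)
  show "mm N Ge ge i j = mid i j" if "i < N" "j < N"
    by (rule opr_inject', unfold opr_mm opr_entries mid) (use Gg[OF that] in \<open>simp add: mm_def flip: scal_mult scal_sum\<close>)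
  show "mm N ge Ge i j = mid i j" if "i < N" "j < N"
    by (rule opr_inject', unfold opr_mm opr_entries mid) (use gG[OF that] in \<open>simp add: mm_def flip: scal_mult scal_sum\<close>)
  show "mm N Ge Me i j = mm N Ge Me j i" if "i < N" "j < N"
    by (rule opr_inject', unfold opr_mm opr_entries) (use GM_sym[OF that] in \<open>simp add: mm_def\<close>)
  show "mm N Ge Ke i j = - mm N Ge Ke j i" if "i < N" "j < N"
    by (rule opr_inject', unfold uminus_ev.rep_eq opr_mm opr_entries) (use GK_skew[OF that] in \<open>simp add: mm_def\<close>)
  show "Ke i j * Ke k l = - (Ke i l * Ke k j)"
    by (rule opr_inject') (use odd_swap[of "b i" j k l] in \<open>simp add: opr_entries times_ev.rep_eq uminus_ev.rep_eq K_def\<close>)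
  show "Ge i j = - Ge j i" if "i < N" "j < N"
    by (rule opr_inject') (simp add: G_skew[OF that] opr_entries uminus_ev.rep_eq scal_minus)
qed

lemma str_Ye: "blk_str N Me Ke (Suc k) = 0"
proof (rule opr_inject')
  have "opr (blk_str N Me Ke (Suc k)) = blk_str N M K (Suc k)"
    by (simp add: blk_str_def tr_def plus_ev.rep_eq zero_ev.rep_eq opr_sum opr_mm opr_Y opr_entries)
  then show "opr (blk_str N Me Ke (Suc k)) = opr 0" using str_Y by (simp add: zero_ev.rep_eq)
qed

lemma half_ev: "Ev (scal (1/2)) + Ev (scal (1/2)) = 1"
proof (rule opr_inject')
  show "opr (Ev (scal (1/2)) + Ev (scal (1/2))) = opr 1"
    unfolding plus_ev.rep_eq one_ev.rep_eq Ev_inverse'[OF alg_scal swp_scal] scal_add[symmetric]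
    by (simp add: scal_1)
qed

text \<open>The identity is applied in \<open>ev\<close>; its factor \<open>fact N\<close> can be
  divided out because the operators form a complex algebra.\<close>

lemma Y_Suc_N:
  assumes "i < N" "j < N"
  shows "Y (Suc N) i j = 0"
proof -
  have "of_nat (fact N) * blk N Me Ke (Suc N) i j = 0"
    by (rule blk_identity(1)[OF even_hyps(1-5), where h = "Ev (scal (1/2))" and L = "\<lambda>_ _. 0"])
       (use assms half_ev str_Ye in auto)
  then have "opr (of_nat (fact N) * blk N Me Ke (Suc N) i j) = opr 0" by simp
  then have "of_nat (fact N) * Y (Suc N) i j = 0"
    by (simp only: times_ev.rep_eq opr_of_nat opr_Y zero_ev.rep_eq)
  then show ?thesis by (rule oper_of_nat_mult_eq_0) simp
qed

text \<open>Multiplying the odd row \<open>a\<close> by the odd element \<open>\<theta>\<^sub>x \<theta>\<^sub>y\<close> moves it into the commutative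
  ring of even elements; since \<open>x\<close> and \<open>y\<close> are fresh, nothing is lost.\<close>

lemma aY_N:
  assumes j: "j < N" and xy: "even x" "odd y"
  shows "theta x * (theta y * (\<Sum>l<N. a l * Y N l j)) = 0"
proof -
  define c where "c = theta x * theta y"
  define L where "L = (\<lambda>(i :: nat) j. Ev (c * a j))"
  have c: "swp 0 1 c" unfolding c_def
    by (rule swp_parity[OF swp_mult[OF swp_theta swp_theta]]) (use xy in simp_all)
  have ca: "swp 0 0 (c * a j)" for j
    by (rule swp_parity[OF swp_mult[OF c swp_a]]) simp_all
  have L: "opr (L i j) = c * a j" for i j
    unfolding L_def by (rule Ev_inverse'[OF _ ca]) (simp add: c_def alg_mult alg_theta alg_entries)
  have LK: "L i j * Ke k l = - (L i l * Ke k j)" for i j k l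
    by (rule opr_inject') (use odd_swap[of c j k l] in \<open>simp add: L opr_entries times_ev.rep_eq uminus_ev.rep_eq\<close>)
  have "of_nat (fact N) * mm N L (blk N Me Ke N) 0 j = 0"
    by (rule blk_identity(2)[OF even_hyps(1-5) LK, where h = "Ev (scal (1/2))"])
       (use j half_ev str_Ye in auto)
  then have "opr (of_nat (fact N) * mm N L (blk N Me Ke N) 0 j) = opr 0" by simp
  then have "of_nat (fact N) * mm N (\<lambda>_ j. c * a j) (Y N) 0 j = 0"
    by (simp only: times_ev.rep_eq opr_of_nat opr_mm opr_Y zero_ev.rep_eq L)
  then have "mm N (\<lambda>_ j. c * a j) (Y N) 0 j = 0" by (rule oper_of_nat_mult_eq_0) simp
  then show ?thesis by (simp add: mm_def c_def mult.assoc sum_distrib_left)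
qed

text \<open>\<open>a\<close> is dual to \<open>b\<close>, and \<open>G Y\<close> is symmetric up to
  sign; so the vanishing of the row \<open>a Y\<close> carries over to the column
  \<open>Y b\<close>.\<close>

lemma GYb:
  assumes j: "j < N"
  shows "(\<Sum>l<N. a l * Y N l j) = (-1) ^ Suc N * (\<Sum>l<N. scal (G j l) * (\<Sum>r<N. Y N l r * b r))"
proof -
  have sym: "(\<Sum>l<N. scal (G i l) * Y N l j) = (-1) ^ Suc N * (\<Sum>l<N. scal (G j l) * Y N l i)" if "i < N" for i
  proof -
    have "mm N Ge (blk N Me Ke N) i j = (-1) ^ Suc N * mm N Ge (blk N Me Ke N) j i"
      by (rule blk_symmetric)
        (erule (1) even_hyps(6), erule (1) even_hyps(3), erule (1) even_hyps(4), rule that, rule j)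
    then have "opr (mm N Ge (blk N Me Ke N) i j) = opr ((-1) ^ Suc N * mm N Ge (blk N Me Ke N) j i)"
      by (rule arg_cong)
    moreover have "opr ((-1) ^ Suc N * z) = (-1) ^ Suc N * opr z" for z
      by (cases "even N") (simp_all add: uminus_ev.rep_eq)
    ultimately have "mm N (\<lambda>i j. scal (G i j)) (Y N) i j = (-1) ^ Suc N * mm N (\<lambda>i j. scal (G i j)) (Y N) j i"
      by (simp only: opr_mm opr_entries opr_Y)
    then show ?thesis by (simp only: mm_def)
  qed
  have "(\<Sum>l<N. a l * Y N l j) = - (\<Sum>l<N. \<Sum>k<N. scal (G l k) * (b k * Y N l j))"
    by (simp add: a_alt sum_distrib_right mult.assoc sum_negf)
  also have "\<dots> = (\<Sum>l<N. \<Sum>k<N. scal (G k l) * Y N l j * b k)"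
    unfolding sum_negf[symmetric]
  proof (intro sum.cong refl)
    fix l k assume lk: "l \<in> {..<N}" "k \<in> {..<N}"
    then have "G l k = - G k l" by (intro G_skew) auto
    then show "- (scal (G l k) * (b k * Y N l j)) = scal (G k l) * Y N l j * b k"
      using b_move[OF swp_Y, of k N l j] by (simp add: scal_minus mult.assoc)
  qed
  also have "\<dots> = (\<Sum>k<N. (\<Sum>l<N. scal (G k l) * Y N l j) * b k)"
    by (subst sum.swap) (simp only: sum_distrib_right)
  also have "\<dots> = (\<Sum>k<N. (-1) ^ Suc N * (\<Sum>l<N. scal (G j l) * Y N l k) * b k)"
    by (intro sum.cong refl) (simp only: sym lessThan_iff)
  also have "\<dots> = (-1) ^ Suc N * (\<Sum>l<N. scal (G j l) * (\<Sum>k<N. Y N l k * b k))"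
    unfolding sum_distrib_left sum_distrib_right mult.assoc by (subst sum.swap) (rule refl)
  finally show ?thesis .
qed

text \<open>The lower right block is zero outright, and with it the corner by the supertrace. The
  odd row has no coefficient at \<open>V\<close> because \<open>x\<close> and \<open>y\<close> are
  fresh, and the column follows by duality, as \<open>G\<close> is invertible.\<close>

lemma vac_coeff_mpow_Th:
  assumes V: "even x" "odd y" "x \<notin> V" "y \<notin> V" and i: "i < Suc N" and j: "j < Suc N"
  shows "vac_coeff (mpow (Suc N) Th (2 * Suc N) i j) V = 0"
proof -
  let ?R = "mpow (Suc N) Th (2 * Suc N)"
  have row: "vac_coeff (\<Sum>l<N. a l * Y N l j) V = 0" if "j < N" for j
    by (rule vac_coeff_fresh[OF aY_N[OF that V(1,2)]]) (use V in auto)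
  have diag: "?R (Suc i) (Suc j) = 0" if "i < N" "j < N" for i j
    by (simp only: mpow_Th_blocks(1)[OF that(2)] Y_Suc_N[OF that])
  have "vac_coeff (\<Sum>l<N. Y N i l * b l) V = 0" if i: "i < N" for i
  proof -
    define w where "w l = vac_coeff (\<Sum>r<N. Y N l r * b r) V" for l
    have Gw: "(\<Sum>l<N. G j l * w l) = 0" if "j < N" for j
    proof -
      have pm: "vac_coeff ((-1) ^ n * T) V = 0 \<longleftrightarrow> vac_coeff T V = 0" for n T
        using vac_coeff_scal[of "(-1) ^ n" T V] by (cases "even n") (simp_all add: scal_minus scal_1)
      show ?thesis
        using row[OF that] unfolding GYb[OF that] pm vac_coeff_sum vac_coeff_scal w_def .
    qed
    have "(\<Sum>k<N. g i k * (\<Sum>l<N. G k l * w l)) = (\<Sum>l<N. mm N g G i l * w l)"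
      unfolding mm_def sum_distrib_left sum_distrib_right mult.assoc by (rule sum.swap)
    also have "\<dots> = mm N mid (\<lambda>l _. w l) i 0"
      unfolding mm_def[of _ mid] using gG[OF i] by (intro sum.cong refl) simp
    also have "\<dots> = w i" using i by (simp add: mm_mid_left)
    finally show ?thesis using Gw by (simp add: w_def)
  qed
  then have col: "vac_coeff (?R (Suc i) 0) V = 0" if "i < N" for i
    using mpow_Th_column[of N] that by (simp del: mpow.simps)
  have corner: "?R 0 0 = 0"
    unfolding supertrace_0 using diag by (intro sum.neutral ballI) auto
  show ?thesis
  proof (cases i)
    case 0
    show ?thesis
    proof (cases j)
      case 0
      then show ?thesis using \<open>i = 0\<close> corner by (simp only: vac_coeff_0)
    next
      case (Suc j')
      then show ?thesis using \<open>i = 0\<close> j row[of j'] mpow_Th_blocks(2)[of j' N] by (simp del: mpow.simps)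
    qed
  next
    case (Suc i')
    show ?thesis
    proof (cases j)
      case 0
      then show ?thesis using Suc i col[of i'] by (simp del: mpow.simps)
    next
      case (Suc j')
      then show ?thesis using \<open>i = Suc i'\<close> i j diag[of i' j'] by (simp only: Suc_less_eq vac_coeff_0)
    qed
  qed
qed

end

section \<open>From the bilinear form to the generic matrix\<close>

lemma scal_left_comm: "T * (scal c * U) = scal c * (T * U)"
  by (simp only: mult.assoc[symmetric] scal_commute)

lemma hom_osp_unit:
  assumes X: "hom_osp n B d X" and i: "i < 2 * n + 1" and j: "j < 2 * n + 1"
  shows "(\<Sum>r<2 * n + 1. X r i * B r j) + sgn_deg d (idx_par i) * (\<Sum>r<2 * n + 1. B i r * X r j) = 0"
proof -
  let ?N = "2 * n + 1"
  define e :: "nat \<Rightarrow> vec" where "e i = (\<lambda>k. if k = i then 1 else 0)" for i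
  have he: "hom_vec ?N (idx_par i) (e i)" if "i < ?N" for i
    using that by (simp add: hom_vec_def e_def)
  have Xe: "mvec ?N X (e i) = (\<lambda>r. X r i)" if "i < ?N" for i
    unfolding mvec_def e_def using that by (simp add: if_distrib cong: if_cong)
  have R: "bil ?N B v (e j) = (\<Sum>r<?N. v r * B r j)" for v
    unfolding bil_def e_def using j by (simp add: if_distrib cong: if_cong)
  have L: "bil ?N B (e i) w = (\<Sum>r<?N. B i r * w r)" for w
  proof -
    have "bil ?N B (e i) w = (\<Sum>k<?N. if k = i then \<Sum>r<?N. B i r * w r else 0)"
      unfolding bil_def e_def by (intro sum.cong refl) auto
    then show ?thesis using i by simp
  qed
  have "bil ?N B (mvec ?N X (e i)) (e j) + sgn_deg d (idx_par i) * bil ?N B (e i) (mvec ?N X (e j)) = 0"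
    using X he[OF i] he[OF j] unfolding hom_osp_def Let_def by blast
  then show ?thesis unfolding Xe[OF i] Xe[OF j] R L .
qed

text \<open>The form is block diagonal, so a kernel vector of its odd block would lie in the
  radical; hence the block has nonzero determinant and the adjugate gives the inverse.\<close>

lemma osp_form_inverse:
  assumes B: "osp_form n B"
  obtains g where "\<And>i j. i < 2 * n \<Longrightarrow> j < 2 * n \<Longrightarrow> mm (2 * n) (\<lambda>i j. B (Suc i) (Suc j)) g i j = mid i j"
    and "\<And>i j. i < 2 * n \<Longrightarrow> j < 2 * n \<Longrightarrow> mm (2 * n) g (\<lambda>i j. B (Suc i) (Suc j)) i j = mid i j"
proof -
  let ?N = "2 * n"
  define A where "A = mat ?N ?N (\<lambda>(i, j). B (Suc i) (Suc j))"
  have A: "A \<in> carrier_mat ?N ?N" by (simp add: A_def)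
  have B0: "B i j = 0" if "i < 2 * n + 1" "j < 2 * n + 1" "idx_par i \<noteq> idx_par j" for i j
    using B that by (simp add: osp_form_def Let_def)
  have nondeg: "v = (\<lambda>_. 0)" if "\<And>k. k \<ge> 2 * n + 1 \<Longrightarrow> v k = 0" "\<And>w. bil (2 * n + 1) B v w = 0" for v
    using B that unfolding osp_form_def Let_def by blast
  have "det A \<noteq> 0"
  proof
    assume "det A = 0"
    then have "det A\<^sup>T = 0" using det_transpose[OF A] by simp
    then obtain v where v: "v \<in> carrier_vec ?N" "v \<noteq> 0\<^sub>v ?N" "A\<^sup>T *\<^sub>v v = 0\<^sub>v ?N"
      using det_0_iff_vec_prod_zero_field[of "A\<^sup>T" ?N] A by auto
    \<comment> \<open>The kernel vector shifted to the odd indices and extended by zero.\<close>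
    define x where "x k = (if k = 0 \<or> k > ?N then 0 else v $ (k - 1))" for k
    have "(\<Sum>i<?N. v $ i * B (Suc i) (Suc j)) = 0" if "j < ?N" for j
    proof -
      have "(A\<^sup>T *\<^sub>v v) $ j = (\<Sum>i<?N. v $ i * B (Suc i) (Suc j))"
        using v(1) that A by (simp add: scalar_prod_def A_def atLeast0LessThan mult.commute)
      then show ?thesis using v(3) that by simp
    qed
    then have "(\<Sum>i<2 * n + 1. x i * B i j) = 0" if "j < 2 * n + 1" for j
      using that B0 by (cases j) (simp_all add: sum.lessThan_Suc_shift x_def idx_par_def del: sum.lessThan_Suc)
    then have "bil (2 * n + 1) B x w = 0" for w
      unfolding bil_def by (subst sum.swap) (simp add: sum_distrib_right[symmetric] del: sum.lessThan_Suc)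
    then have x: "x = (\<lambda>_. 0)" by (intro nondeg) (auto simp: x_def)
    have "v $ i = 0" if "i < ?N" for i
      using that fun_cong[OF x, of "Suc i"] x_def[of "Suc i"] by simp
    then have "v = 0\<^sub>v ?N" using v(1) by (intro eq_vecI) auto
    then show False using v(2) by simp
  qed
  define g where "g i j = adj_mat A $$ (i, j) / det A" for i j
  have 1: "mm ?N (\<lambda>i j. B (Suc i) (Suc j)) g i j = mid i j" if "i < ?N" "j < ?N" for i j
  proof -
    have "(A * adj_mat A) $$ (i, j) = (\<Sum>k<?N. B (Suc i) (Suc k) * adj_mat A $$ (k, j))"
      using that adj_mat(1)[OF A] A by (simp add: scalar_prod_def A_def atLeast0LessThan)
    then have "(\<Sum>k<?N. B (Suc i) (Suc k) * adj_mat A $$ (k, j)) = det A * mid i j"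
      using adj_mat(2)[OF A] that by (simp add: mid_def)
    then show ?thesis using \<open>det A \<noteq> 0\<close>
      by (simp add: mm_def g_def sum_divide_distrib[symmetric] mid_def)
  qed
  have 2: "mm ?N g (\<lambda>i j. B (Suc i) (Suc j)) i j = mid i j" if "i < ?N" "j < ?N" for i j
  proof -
    have "(adj_mat A * A) $$ (i, j) = (\<Sum>k<?N. adj_mat A $$ (i, k) * B (Suc k) (Suc j))"
      using that adj_mat(1)[OF A] A by (simp add: scalar_prod_def A_def atLeast0LessThan)
    then have "(\<Sum>k<?N. adj_mat A $$ (i, k) * B (Suc k) (Suc j)) = det A * mid i j"
      using adj_mat(3)[OF A] that by (simp add: mid_def)
    then show ?thesis using \<open>det A \<noteq> 0\<close>
      by (simp add: mm_def g_def sum_divide_distrib[symmetric] mid_def)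
  qed
  show ?thesis by (rule that[OF 1 2])
qed

text \<open>Otherwise the even basis vector would lie in the radical, as it is orthogonal to the odd
  part.\<close>

lemma osp_form_0_0:
  assumes B: "osp_form n B"
  shows "B 0 0 \<noteq> 0"
proof
  assume B00: "B 0 0 = 0"
  have B0: "B 0 j = 0" if "j < 2 * n + 1" for j
    using B that B00 by (cases j) (simp_all add: osp_form_def Let_def idx_par_def)
  define e :: vec where "e k = (if k = 0 then 1 else 0)" for k
  have "bil (2 * n + 1) B e w = 0" for w
    unfolding bil_def by (intro sum.neutral ballI) (auto simp: e_def B0)
  moreover have "\<forall>k\<ge>2 * n + 1. e k = 0" by (simp add: e_def)
  ultimately have "e = (\<lambda>_. 0)"
    using B unfolding osp_form_def Let_def by blast
  from fun_cong[OF this, of 0] show False using e_def[of 0] by simp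
qed

lemma osp_generic_generic:
  assumes B: "osp_form n B" and X: "\<And>k. k < m \<Longrightarrow> hom_osp n B (p k) (X k)"
  obtains G g where "osp_generic (2 * n) (generic m X p) G g"
proof -
  let ?N = "2 * n"
  define H where "H i j = B (Suc i) (Suc j)" for i j
  obtain h where h: "\<And>i j. i < ?N \<Longrightarrow> j < ?N \<Longrightarrow> mm ?N H h i j = mid i j"
      "\<And>i j. i < ?N \<Longrightarrow> j < ?N \<Longrightarrow> mm ?N h H i j = mid i j"
    using osp_form_inverse[OF B] unfolding H_def by metis
  \<comment> \<open>With this factor the relation for odd \<open>X\<close> expresses the row
    \<open>X k 0 (Suc j)\<close> through the column \<open>X k (Suc i) 0\<close> with coefficients
    exactly \<open>G\<close>.\<close>
  define c where "c = - (1 / B 0 0)"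
  have c: "c \<noteq> 0" "c * B 0 0 = -1" using osp_form_0_0[OF B] by (simp_all add: c_def)
  define G where "G i j = c * H i j" for i j
  define g where "g i j = h i j / c" for i j
  have B0: "B i j = 0" if "i < 2 * n + 1" "j < 2 * n + 1" "idx_par i \<noteq> idx_par j" for i j
    using B that by (simp add: osp_form_def Let_def)
  have skew: "H i j = - H j i" if "i < ?N" "j < ?N" for i j
  proof -
    have "Suc i < 2 * n + 1" "Suc j < 2 * n + 1" "idx_par (Suc i)" "idx_par (Suc j)"
      using that by (simp_all add: idx_par_def)
    then show ?thesis using B unfolding H_def osp_form_def Let_def by blast
  qed
  have par: "X k i j = 0" if "k < m" "((i = 0) \<noteq> (j = 0)) \<noteq> p k" for k i j
    using X[OF that(1)] that(2) unfolding hom_osp_def Let_def hom_mat_def idx_par_def by blast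
  note unit = hom_osp_unit[OF X, unfolded Suc_eq_plus1[symmetric] sum.lessThan_Suc_shift]
  have X00: "X k 0 0 = 0" if "k < m" for k
  proof (cases "p k")
    case True
    then show ?thesis using par that by simp
  next
    case False
    \<comment> \<open>The orthogonal algebra of a one-dimensional space is zero.\<close>
    have "X k 0 0 * B 0 0 + B 0 0 * X k 0 0 = 0"
      using unit[OF that, of 0 0] B0 False
      by (simp add: sgn_deg_def idx_par_def del: sum.lessThan_Suc)
    then show ?thesis using osp_form_0_0[OF B] by (simp add: mult.commute)
  qed
  have row: "X k 0 (Suc j) = (\<Sum>i<?N. G i j * X k (Suc i) 0)" if "k < m" "j < ?N" for k j
  proof (cases "p k")
    case True
    have "(\<Sum>i<?N. X k (Suc i) 0 * B (Suc i) (Suc j)) + B 0 0 * X k 0 (Suc j) = 0"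
      using unit[OF that(1), of 0 "Suc j"] B0 X00 that True
      by (simp add: sgn_deg_def idx_par_def del: sum.lessThan_Suc)
    then have "c * (\<Sum>i<?N. X k (Suc i) 0 * B (Suc i) (Suc j)) + c * B 0 0 * X k 0 (Suc j) = 0"
      by (simp add: mult.assoc flip: distrib_left)
    then show ?thesis by (simp add: c(2) G_def H_def sum_distrib_left algebra_simps)
  next
    case False
    then show ?thesis using par that by simp
  qed
  have sym: "(\<Sum>r<?N. G i r * X k (Suc r) (Suc j)) = (\<Sum>r<?N. G j r * X k (Suc r) (Suc i))"
    if "k < m" "i < ?N" "j < ?N" for k i j
  proof (cases "p k")
    case True
    then show ?thesis using par that by simp
  next
    case False
    have "(\<Sum>r<?N. X k (Suc r) (Suc i) * H r j) + (\<Sum>r<?N. H i r * X k (Suc r) (Suc j)) = 0"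
      using unit[OF that(1), of "Suc i" "Suc j"] B0 that False
      by (simp add: sgn_deg_def idx_par_def H_def del: sum.lessThan_Suc)
    moreover have "(\<Sum>r<?N. X k (Suc r) (Suc i) * H r j) = - (\<Sum>r<?N. H j r * X k (Suc r) (Suc i))"
      unfolding sum_negf[symmetric]
    proof (intro sum.cong refl)
      fix r assume "r \<in> {..<?N}"
      then have "H r j = - H j r" using skew that by blast
      then show "X k (Suc r) (Suc i) * H r j = - (H j r * X k (Suc r) (Suc i))" by simp
    qed
    ultimately show ?thesis by (simp add: G_def mult.assoc flip: sum_distrib_left)
  qed
  let ?T = "generic m X p"
  \<comment> \<open>The commutation is demanded only where \<open>X k i j\<close> is nonzero, since
    there the block of (i, j) determines \<open>p k\<close>.\<close>
  have moves: "scal (X k i j) * theta (gen p k) * T = s * (T * (scal (X k i j) * theta (gen p k)))"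
    if "X k i j \<noteq> 0 \<Longrightarrow> theta (gen p k) * T = s * (T * theta (gen p k))" "s = 1 \<or> s = -1" for k i j T s
  proof (cases "X k i j = 0")
    case False
    then show ?thesis using that
      by (auto simp: mult.assoc scal_left_comm)
  qed (simp add: scal_0)
  have "osp_generic ?N ?T G g"
  proof
    show "?T 0 0 = 0" unfolding generic_def by (rule sum.neutral) (simp add: X00 scal_0)
    show "?T i j \<in> alg" for i j
      unfolding generic_def by (intro alg_sum alg_mult alg_scal alg_theta)
    show "?T i j * T = (-1) ^ d * (T * ?T i j)" if "(i = 0) = (j = 0)" "swp d q T" for i j d q T
      unfolding generic_def sum_distrib_left sum_distrib_right
    proof (intro sum.cong refl moves)
      fix k assume "k \<in> {..<m}" "X k i j \<noteq> 0"
      then have "\<not> p k" using par[of k i j] that by auto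
      then show "theta (gen p k) * T = (-1) ^ d * (T * theta (gen p k))"
        using that(2) by (simp add: swp_def odd_gen)
    qed (simp add: minus_one_power_iff)
    show "?T i j * T = (-1) ^ q * (T * ?T i j)" if "(i = 0) \<noteq> (j = 0)" "swp d q T" for i j d q T
      unfolding generic_def sum_distrib_left sum_distrib_right
    proof (intro sum.cong refl moves)
      fix k assume "k \<in> {..<m}" "X k i j \<noteq> 0"
      then have "p k" using par[of k i j] that by auto
      then show "theta (gen p k) * T = (-1) ^ q * (T * theta (gen p k))"
        using that(2) by (simp add: swp_def odd_gen)
    qed (simp add: minus_one_power_iff)
    have sw: "swp 1 (if p k then 0 else 1) (scal x * theta (gen p k))" for k x
      using swp_mult[OF swp_scal swp_theta[of "gen p k"], of x] by (simp add: odd_gen)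
    show "swp 1 1 (?T i j)" if "(i = 0) = (j = 0)" for i j
      unfolding generic_def
    proof (rule swp_sum)
      fix k assume "k \<in> {..<m}"
      then show "swp 1 1 (scal (X k i j) * theta (gen p k))"
        using sw[of k "X k i j"] par[of k i j] that by (cases "p k") (simp_all add: scal_0 swp_0)
    qed
    show "swp 1 0 (?T i j)" if "(i = 0) \<noteq> (j = 0)" for i j
      unfolding generic_def
    proof (rule swp_sum)
      fix k assume "k \<in> {..<m}"
      then show "swp 1 0 (scal (X k i j) * theta (gen p k))"
        using sw[of k "X k i j"] par[of k i j] that by (cases "p k") (auto simp: scal_0 swp_0)
    qed
    show "G i j = - G j i" if "i < ?N" "j < ?N" for i j
      unfolding G_def by (subst skew[OF that]) simp
    show "mm ?N G g i j = mid i j" if "i < ?N" "j < ?N" for i j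
      using h(1)[OF that] c(1) by (simp add: mm_def G_def g_def)
    show "mm ?N g G i j = mid i j" if "i < ?N" "j < ?N" for i j
      using h(2)[OF that] c(1) by (simp add: mm_def G_def g_def)
    have lin: "(\<Sum>i<?N. scal (f i) * ?T (r i) s) = (\<Sum>k<m. scal (\<Sum>i<?N. f i * X k (r i) s) * theta (gen p k))"
      for f r s
      unfolding generic_def scal_sum scal_mult sum_distrib_left sum_distrib_right mult.assoc by (rule sum.swap)
    show "?T 0 (Suc j) = (\<Sum>i<?N. scal (G i j) * ?T (Suc i) 0)" if "j < ?N" for j
      unfolding lin unfolding generic_def using row that by (intro sum.cong refl) auto
    show "(\<Sum>k<?N. scal (G i k) * ?T (Suc k) (Suc j)) = (\<Sum>k<?N. scal (G j k) * ?T (Suc k) (Suc i))"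
      if "i < ?N" "j < ?N" for i j
      unfolding lin
    proof (intro sum.cong refl)
      fix k assume "k \<in> {..<m}"
      then show "scal (\<Sum>r<?N. G i r * X k (Suc r) (Suc j)) * theta (gen p k)
          = scal (\<Sum>r<?N. G j r * X k (Suc r) (Suc i)) * theta (gen p k)"
        using sym[OF _ that, of k] by simp
    qed
  qed
  then show ?thesis by (rule that)
qed

text \<open>Matrices are functions on all index pairs: a row index outside the range kills the first
  factor, and a column index outside kills \<open>mone\<close> and every product ending in
  it.\<close>

lemma mprod_outside:
  assumes "\<not> (i < N \<and> j < N)" "hom_mat N d A"
  shows "mprod N (A # As) i j = 0"
proof (cases "i < N")
  case False
  then have "A i k = 0" for k using assms(2) unfolding hom_mat_def by blast
  then show ?thesis by (simp add: mprod_def mmul_def)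
next
  case True
  then have "\<not> j < N" using assms(1) by simp
  have "foldr (mmul N) As (mone N) i j = 0" for As i
    using \<open>\<not> j < N\<close> by (induction As arbitrary: i) (auto simp: mone_def mmul_def)
  from this[of "A # As"] show ?thesis by (simp only: mprod_def)
qed

theorem theorem5p1:
  fixes n :: nat and B :: mat and X :: "nat \<Rightarrow> mat" and p :: "nat \<Rightarrow> bool"
  assumes "n \<ge> 1"
    and "osp_form n B"
    and "\<forall>k < 4*n+2. hom_osp n B (p k) (X k)"
  shows "superA (2*n+1) (4*n+2) X p = (\<lambda>i j. 0)"
proof (intro ext)
  fix i j
  let ?m = "4 * n + 2" and ?N = "2 * n + 1"
  show "superA ?N ?m X p i j = 0"
  proof (cases "i < ?N \<and> j < ?N")
    case True
    obtain G g where "osp_generic (2 * n) (generic ?m X p) G g"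
      using osp_generic_generic[of n B ?m p X] assms(2,3) by blast
    then interpret osp_generic "2 * n" "generic ?m X p" G g .
    \<comment> \<open>The square of \<Theta> occurs to the power \<open>2n + 1\<close>, one more
      than the dimension of the odd part.\<close>
    have m: "?m = 2 * Suc (2 * n)" by simp
    \<comment> \<open>Generator indices stay below \<open>2 * ?m\<close>, so \<open>2 * ?m\<close>
      and \<open>2 * ?m + 1\<close> are free, one of each parity.\<close>
    have fresh: "2 * ?m + e \<notin> gen p ` {..<?m}" for e by (auto simp: gen_def split: if_splits)
    have "vac_coeff (mpow (Suc (2 * n)) (generic ?m X p) (2 * Suc (2 * n)) i j) (gen p ` {..<?m}) = 0"
      using True fresh[of 0] fresh[of 1] by (intro vac_coeff_mpow_Th[of "2 * ?m" "2 * ?m + 1"]) auto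
    then show ?thesis using True superA_eq_vac_coeff[of i ?N ?m X p j] m by simp
  next
    case False
    show ?thesis
      unfolding superA_def
    proof (rule sum.neutral, rule ballI)
      fix \<sigma> assume "\<sigma> \<in> {\<sigma>. \<sigma> permutes {0..<?m}}"
      then have "\<sigma> 0 < ?m" using permutes_in_image[of \<sigma> "{0..<?m}" 0] by simp
      then have "hom_mat ?N (p (\<sigma> 0)) (X (\<sigma> 0))"
        using assms(3) unfolding hom_osp_def Let_def by blast
      moreover have "map (\<lambda>k. X (\<sigma> k)) [0..<?m] = X (\<sigma> 0) # map (\<lambda>k. X (\<sigma> k)) [1..<?m]"
        by (subst upt_conv_Cons) simp_all
      ultimately have "mprod ?N (map (\<lambda>k. X (\<sigma> k)) [0..<?m]) i j = 0"
        using mprod_outside[OF False] by metis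
      then show "of_int (sign \<sigma>) * (-1) ^ Kinv ?m \<sigma> p * mprod ?N (map (\<lambda>k. X (\<sigma> k)) [0..<?m]) i j = 0"
        by simp
    qed
  qed
qed

end
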